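(* There exist universal positive constants $c_0,c_4,c_5$ such that the following holds. Let $\varepsilon\in(0,1)$, let $\bm{a}_1,\dots,\bm{a}_N\in\mathbb{C}^D$ be i.i.d. uniform on the sphere $\{\bm{x}\in\mathbb{C}^D:\|\bm{x}\|_2=\sqrt{D}\}$ and independent of $\bm{H},\bm{Z}$. Let $\bm{\gamma}^{\natural}\in\mathbb{R}^N_+$ have support $S^{\natural}$ with $|S^{\natural}|=K$, let $\bm{Y}=\bm{A}\,\mathrm{diag}(\bm{\gamma}^{\natural})^{1/2}\bm{H}+\bm{Z}$, $\widehat{\bm{\Sigma}}_y=\frac1M\bm{Y}\bm{Y}^*$, and for $k\in[N]$ let $$\mathcal{Y}_k=\sum_{1\le i,j\le D}\overline{a}_{k,i}a_{k,j}\widehat{\Sigma}_y(i,j).$$ Let $\hat S$ be the set of indices of the $K$ largest values among $\mathcal{Y}_1,\dots,\mathcal{Y}_N$. Write $\gamma^{\natural}_{\min},\gamma^{\natural}_{\max}$ for the smallest and largest entries of $\bm{\gamma}^{\natural}$ on $S^{\natural}$ and $c_\gamma=\gamma^{\natural}_{\max}/\gamma^{\natural}_{\min}$. If $$M\ge c_4\left(c_\gamma K+\frac{\sigma^2}{\gamma^{\natural}_{\min}}\right)^2\log\left(\frac{(eD)^2}{\varepsilon}\right)\quad\text{and}\quad K\le c_5\frac{D}{c_\gamma\log(ND)},$$ then $\mathbb{P}(\hat S=S^{\natural})\ge1-\varepsilon-\frac{c_0}{D\sqrt{D}}$.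
   Context: Model: $\bm{A}=[\bm{a}_1,\dots,\bm{a}_N]\in\mathbb{C}^{D\times N}$, $a_{k,i}$ is the $i$-th entry of $\bm{a}_k$; $\bm{H}\in\mathbb{C}^{N\times M}$ has i.i.d. $\mathcal{CN}(0,1)$ entries, $\bm{Z}\in\mathbb{C}^{D\times M}$ has i.i.d. $\mathcal{CN}(0,\sigma^2)$ entries, $\bm{H},\bm{Z}$ independent; $\widehat{\Sigma}_y(i,j)$ is the $(i,j)$ entry of $\widehat{\bm{\Sigma}}_y$; $\overline{a}$ denotes complex conjugate; $[N]=\{1,\dots,N\}$. *)

theory Defs
  imports "HOL-Probability.Probability"
begin

definition cvec_norm :: "nat \<Rightarrow> (nat \<Rightarrow> complex) \<Rightarrow> real" where
  "cvec_norm D x = sqrt (\<Sum>i<D. (cmod (x i))^2)"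

definition lebesgue_CD :: "nat \<Rightarrow> (nat \<Rightarrow> complex) measure" where
  "lebesgue_CD D = PiM {..<D} (\<lambda>_. lborel)"

text \<open>Uniform distribution on the sphere of radius sqrt D in C^D, as the normalized
  cone measure: radial projection of the uniform distribution on the unit ball.\<close>
definition unif_sphere :: "nat \<Rightarrow> (nat \<Rightarrow> complex) measure" where
  "unif_sphere D =
     distr (uniform_measure (lebesgue_CD D) {x \<in> space (lebesgue_CD D). cvec_norm D x \<le> 1})
           (PiM {..<D} (\<lambda>_. borel))
           (\<lambda>x. \<lambda>i\<in>{..<D}. complex_of_real (sqrt (real D) / cvec_norm D x) * x i)"

text \<open>Circularly symmetric complex Gaussian CN(0,v): real and imaginary parts
  independent N(0,v/2); degenerate (point mass at 0) for v = 0.\<close>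
definition cgauss :: "real \<Rightarrow> complex measure" where
  "cgauss v = (if v = 0 then return borel 0 else
     distr (density lborel (normal_density 0 (sqrt (v/2))) \<Otimes>\<^sub>M
            density lborel (normal_density 0 (sqrt (v/2))))
           borel (\<lambda>(x, y). Complex x y))"

text \<open>Joint probability space of (A, H, Z): A k = column a_k (A k i = a_{k,i}),
  H (k,m) entries of H, Z (i,m) entries of Z, all independent.\<close>
definition model_space :: "nat \<Rightarrow> nat \<Rightarrow> nat \<Rightarrow> real \<Rightarrow>
    ((nat \<Rightarrow> nat \<Rightarrow> complex) \<times> ((nat \<times> nat) \<Rightarrow> complex) \<times> ((nat \<times> nat) \<Rightarrow> complex)) measure" where
  "model_space D N M \<sigma> =
     PiM {..<N} (\<lambda>_. unif_sphere D) \<Otimes>\<^sub>M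
     (PiM ({..<N} \<times> {..<M}) (\<lambda>_. cgauss 1) \<Otimes>\<^sub>M
      PiM ({..<D} \<times> {..<M}) (\<lambda>_. cgauss (\<sigma>^2)))"

definition Ymat :: "nat \<Rightarrow> (nat \<Rightarrow> real) \<Rightarrow> (nat \<Rightarrow> nat \<Rightarrow> complex) \<Rightarrow>
    ((nat \<times> nat) \<Rightarrow> complex) \<Rightarrow> ((nat \<times> nat) \<Rightarrow> complex) \<Rightarrow> nat \<Rightarrow> nat \<Rightarrow> complex" where
  "Ymat N \<gamma> A H Z i m = (\<Sum>k<N. A k i * complex_of_real (sqrt (\<gamma> k)) * H (k, m)) + Z (i, m)"

definition Sigma_hat :: "nat \<Rightarrow> nat \<Rightarrow> (nat \<Rightarrow> real) \<Rightarrow> (nat \<Rightarrow> nat \<Rightarrow> complex) \<Rightarrow>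
    ((nat \<times> nat) \<Rightarrow> complex) \<Rightarrow> ((nat \<times> nat) \<Rightarrow> complex) \<Rightarrow> nat \<Rightarrow> nat \<Rightarrow> complex" where
  "Sigma_hat N M \<gamma> A H Z i j =
     (1 / of_nat M) * (\<Sum>m<M. Ymat N \<gamma> A H Z i m * cnj (Ymat N \<gamma> A H Z j m))"

definition calY :: "nat \<Rightarrow> nat \<Rightarrow> nat \<Rightarrow> (nat \<Rightarrow> real) \<Rightarrow> (nat \<Rightarrow> nat \<Rightarrow> complex) \<Rightarrow>
    ((nat \<times> nat) \<Rightarrow> complex) \<Rightarrow> ((nat \<times> nat) \<Rightarrow> complex) \<Rightarrow> nat \<Rightarrow> complex" where
  "calY D N M \<gamma> A H Z k =
     (\<Sum>i<D. \<Sum>j<D. cnj (A k i) * A k j * Sigma_hat N M \<gamma> A H Z i j)"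

text \<open>The event "the indices of the K largest values of calY_1..calY_N are exactly S":
  every value indexed by S strictly exceeds every value indexed outside S
  (calY_k is real; we compare real parts).\<close>
definition top_set_is :: "nat \<Rightarrow> (nat \<Rightarrow> complex) \<Rightarrow> nat set \<Rightarrow> bool" where
  "top_set_is N v S \<longleftrightarrow> S \<subseteq> {..<N} \<and> (\<forall>k\<in>S. \<forall>l\<in>{..<N} - S. Re (v l) < Re (v k))"

end

theory Submission
  imports Defs
begin

text \<open>
  Project the columns of Y onto a column of A: \<open>a\<^sub>k\<^sup>* Y\<close> is a linear combination of
  the rows of H indexed by the support and the rows of Z, with coefficients
  \<open>sqrt (\<gamma> l) \<langle>a\<^sub>k, a\<^sub>l\<rangle>\<close> and the conjugate entries of \<open>a\<^sub>k\<close>. Hence the statistic of index k is a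
  quadratic form in these coefficients whose matrix is the empirical Gram matrix of the rows of H
  and Z, and the randomness of A and of (H, Z) can be treated by two separate events.

  On the first, all norms are exactly \<open>sqrt D\<close> and all squared correlations are at most
  \<open>D R\<close> with \<open>R = 32 ln (N D)\<close>; then the expected form is at least \<open>g D\<^sup>2 + \<sigma>\<^sup>2 D\<close> on the support
  and at most \<open>g D\<^sup>2 / 4 + \<sigma>\<^sup>2 D\<close> off it, where g is the smallest power. On the second, every entry of
  the Gram matrix deviates by at most a small multiple of \<open>1 / Q\<close>,
  \<open>Q = c\<^sub>\<gamma> K + \<sigma>\<^sup>2 / g\<close>, after normalisation. Since the deviation of the form is controlled by the
  squared \<open>l\<^sup>1\<close> norm of the coefficients, only \<open>O(D\<^sup>2)\<close> entries have to be controlled, and no union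
  bound over the N columns enters the condition on M.
\<close>

section \<open>Complex Gaussians\<close>

text \<open>The coefficients \<open>proj_coeff\<close> depend on A, but the Gram event controls the
  form for all coefficient vectors at once. Hence nothing is conditioned on A: recovery is
  deterministic on the intersection of the two events, and the probabilities of their complements
  are added. The price is an l1 norm of the coefficients, and this is the origin of the square in
  the condition on M: the squared weighted l1 norm is of order Q g D^2, the gap between the means is
  of order g D^2, so the Gram entries must be accurate to order 1 / Q, which takes M of order Q^2
  times a logarithm. The correlation event meets another obstacle: \<open>unif_sphere\<close> is the
  radial projection of the uniform distribution on a ball, whose coordinates are dependent. A
  correlation event is invariant under positive scaling, and on such sets the ball can be exchanged
  for a Gaussian with independent coordinates. The factor 32 in R makes a pair of columns fail with
  probability of order (N D)^(-2), which pays for all N^2 pairs and leaves 5 / D^2.\<close>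

lemma measurable_Complex [measurable]:
  assumes [measurable]: "f \<in> borel_measurable M" "g \<in> borel_measurable M"
  shows "(\<lambda>x. Complex (f x) (g x)) \<in> borel_measurable M"
proof -
  have "(\<lambda>x. complex_of_real (f x) + \<i> * complex_of_real (g x)) \<in> borel_measurable M"
    by measurable
  then show ?thesis by (simp add: Complex_eq)
qed

lemma measurable_cnj [measurable]: "cnj \<in> borel_measurable borel"
  by (intro borel_measurable_continuous_onI continuous_intros)

lemma exp_half_le_2: "exp (1 / 2 :: real) \<le> 2"
proof -
  have "exp (1 / 2 :: real) ^ 2 = exp 1" by (simp add: exp_double[symmetric])
  also have "\<dots> \<le> 2 ^ 2" using exp_le by simp
  finally show ?thesis by (rule power2_le_imp_le) simp
qed

text \<open>Since |z| is at most |Re z| + |Im z|, one of the two is at least half of |z|, and a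
  quarter turn makes it a positive real part. This replaces a modulus by four one-sided linear
  quantities, to which exponential moments apply.\<close>

lemma exists_quarter_turn:
  "\<exists>c\<in>{1, -1, \<i>, -\<i>}. cmod z / 2 \<le> Re (c * z)"
proof (rule ccontr)
  assume "\<not> ?thesis"
  then have "\<bar>Re z\<bar> < cmod z / 2" "\<bar>Im z\<bar> < cmod z / 2" unfolding abs_less_iff by auto
  then show False using cmod_le[of z] by simp
qed

lemma normal_density_0:
  assumes "v > 0"
  shows "normal_density 0 (sqrt (v/2)) x = exp (- x\<^sup>2 / v) / sqrt (pi * v)"
  using assms by (simp add: normal_density_def field_simps)

text \<open>Completing the square: the integrand is a constant multiple of the normal density with
  mean b / (2 a) and variance 1 / (2 a).\<close>

lemma nn_integral_exp_quadratic:
  fixes a b :: real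
  assumes a: "a > 0"
  shows "(\<integral>\<^sup>+x. ennreal (exp (- a * x\<^sup>2 + b * x)) \<partial>lborel) = ennreal (sqrt (pi / a) * exp (b\<^sup>2 / (4 * a)))"
proof -
  let ?s = "sqrt (1 / (2 * a))" and ?m = "b / (2 * a)"
  have eq: "exp (- a * x\<^sup>2 + b * x) = sqrt (pi / a) * exp (b\<^sup>2 / (4 * a)) * normal_density ?m ?s x" for x
  proof -
    have s2: "?s\<^sup>2 = 1 / (2 * a)" using a by simp
    have "- (x - ?m)\<^sup>2 / (2 * ?s\<^sup>2) = - a * x\<^sup>2 + b * x - b\<^sup>2 / (4 * a)"
      unfolding s2 using a by (simp add: field_simps power2_eq_square)
    moreover have "sqrt (2 * pi * ?s\<^sup>2) = sqrt (pi / a)" unfolding s2 by simp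
    ultimately have "normal_density ?m ?s x = 1 / sqrt (pi / a) * exp (- a * x\<^sup>2 + b * x - b\<^sup>2 / (4 * a))"
      unfolding normal_density_def by simp
    then show ?thesis using a by (simp add: exp_diff)
  qed
  have nd: "(\<integral>\<^sup>+x. ennreal (normal_density ?m ?s x) \<partial>lborel) = 1"
    using a by (subst nn_integral_eq_integral) auto
  show ?thesis
    unfolding eq using a
    by (subst ennreal_mult) (auto simp: nn_integral_cmult nd)
qed

text \<open>\<open>cgauss\<close> is built from a pair of real normals, whereas the integrals below
  run over complex Lebesgue measure; agreement on boxes identifies the two descriptions.\<close>

lemma lborel_complex: "(lborel :: complex measure) = distr (lborel \<Otimes>\<^sub>M lborel) borel (\<lambda>(x, y). Complex x y)"
proof (rule lborel_eqI)
  fix l u :: complex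
  assume le: "\<And>b. b \<in> Basis \<Longrightarrow> l \<bullet> b \<le> u \<bullet> b"
  have *: "Re l \<le> Re u" "Im l \<le> Im u" using le[of 1] le[of \<i>] by (auto simp: Basis_complex_def)
  have m: "(\<lambda>(x::real, y::real). Complex x y) \<in> lborel \<Otimes>\<^sub>M lborel \<rightarrow>\<^sub>M borel" 
    unfolding case_prod_beta by measurable
  have "emeasure (distr (lborel \<Otimes>\<^sub>M lborel) borel (\<lambda>(x, y). Complex x y)) (box l u)
    = emeasure (lborel \<Otimes>\<^sub>M lborel) ({Re l<..<Re u} \<times> {Im l<..<Im u})"
    by (subst emeasure_distr[OF m])
       (auto intro!: arg_cong2[where f = emeasure] simp: box_def Basis_complex_def space_pair_measure)
  also have "\<dots> = ennreal (Re u - Re l) * ennreal (Im u - Im l)"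
    using * by (subst lborel.emeasure_pair_measure_Times) auto
  finally show "emeasure (distr (lborel \<Otimes>\<^sub>M lborel) borel (\<lambda>(x, y). Complex x y)) (box l u)
    = ennreal (\<Prod>b\<in>Basis. (u - l) \<bullet> b)"
    using * by (simp add: Basis_complex_def ennreal_mult)
qed simp

lemma nn_integral_pair_times:
  assumes "sigma_finite_measure N" and [measurable]: "f \<in> borel_measurable M" "g \<in> borel_measurable N"
  shows "(\<integral>\<^sup>+(x, y). f x * g y \<partial>(M \<Otimes>\<^sub>M N)) = (\<integral>\<^sup>+x. f x \<partial>M) * (\<integral>\<^sup>+y. g y \<partial>N)"
proof -
  interpret sigma_finite_measure N by fact
  show ?thesis
    by (subst nn_integral_fst[symmetric]) (auto simp: nn_integral_cmult nn_integral_multc)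
qed

lemma nn_integral_lborel_complex_times:
  assumes [measurable]: "f \<in> borel_measurable borel" "g \<in> borel_measurable borel"
  shows "(\<integral>\<^sup>+z. f (Re z) * g (Im z) \<partial>lborel) = (\<integral>\<^sup>+x. f x \<partial>lborel) * (\<integral>\<^sup>+y. g y \<partial>lborel)"
proof -
  have m[measurable]: "(\<lambda>(x::real, y::real). Complex x y) \<in> lborel \<Otimes>\<^sub>M lborel \<rightarrow>\<^sub>M borel" 
    unfolding case_prod_beta by measurable
  have "(\<integral>\<^sup>+z. f (Re z) * g (Im z) \<partial>lborel) = (\<integral>\<^sup>+(x, y). f x * g y \<partial>(lborel \<Otimes>\<^sub>M lborel))"
    by (subst lborel_complex, subst nn_integral_distr) (auto simp: case_prod_beta')
  then show ?thesis
    by (simp add: nn_integral_pair_times sigma_finite_lborel)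
qed

text \<open>The linear term serves the exponential tilting used for the sphere; with w = 0 the
  formula gives the exponential moments of the squared modulus.\<close>

lemma nn_integral_complex_gauss:
  fixes a :: real and w :: complex
  assumes a: "a > 0"
  shows "(\<integral>\<^sup>+z. ennreal (exp (- a * (cmod z)\<^sup>2 + Re (w * z))) \<partial>lborel)
    = ennreal (pi / a * exp ((cmod w)\<^sup>2 / (4 * a)))"
proof -
  have "(\<integral>\<^sup>+z. ennreal (exp (- a * (cmod z)\<^sup>2 + Re (w * z))) \<partial>lborel)
    = (\<integral>\<^sup>+z. ennreal (exp (- a * (Re z)\<^sup>2 + Re w * Re z)) * ennreal (exp (- a * (Im z)\<^sup>2 + (- Im w) * Im z)) \<partial>lborel)"
    by (intro nn_integral_cong)
       (simp add: cmod_power2 ennreal_mult[symmetric] exp_add[symmetric] algebra_simps)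
  also have "\<dots> = ennreal (sqrt (pi / a) * exp ((Re w)\<^sup>2 / (4 * a))) * ennreal (sqrt (pi / a) * exp ((Im w)\<^sup>2 / (4 * a)))"
    using nn_integral_exp_quadratic[OF a, of "Re w"] nn_integral_exp_quadratic[OF a, of "- Im w"]
    by (subst nn_integral_lborel_complex_times) auto
  also have "\<dots> = ennreal (pi / a * exp ((cmod w)\<^sup>2 / (4 * a)))"
  proof -
    have "(sqrt (pi / a) * exp ((Re w)\<^sup>2 / (4 * a))) * (sqrt (pi / a) * exp ((Im w)\<^sup>2 / (4 * a)))
      = (sqrt (pi / a) * sqrt (pi / a)) * exp ((Re w)\<^sup>2 / (4 * a) + (Im w)\<^sup>2 / (4 * a))"
      unfolding exp_add by (simp only: ac_simps)
    also have "sqrt (pi / a) * sqrt (pi / a) = pi / a" using a by (intro real_sqrt_mult_self[THEN trans]) simp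
    finally show ?thesis
      using a by (subst ennreal_mult[symmetric]) (auto simp: cmod_power2 add_divide_distrib)
  qed
  finally show ?thesis .
qed

lemma cgauss_eq_density:
  assumes v: "v > 0"
  shows "cgauss v = density lborel (\<lambda>z. ennreal (exp (- (cmod z)\<^sup>2 / v) / (pi * v)))"
proof -
  let ?n = "\<lambda>x. ennreal (normal_density 0 (sqrt (v/2)) x)"
  have m[measurable]: "(\<lambda>(x::real, y::real). Complex x y) \<in> lborel \<Otimes>\<^sub>M lborel \<rightarrow>\<^sub>M borel" 
    unfolding case_prod_beta by measurable
  interpret N: prob_space "density lborel (normal_density 0 (sqrt (v/2)))"
    using v by (intro prob_space_normal_density) auto
  have "density lborel ?n \<Otimes>\<^sub>M density lborel ?n = density (lborel \<Otimes>\<^sub>M lborel) (\<lambda>(x, y). ?n x * ?n y)"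
    by (intro pair_measure_density) (auto intro: sigma_finite_lborel N.sigma_finite_measure_axioms)
  also have "\<dots> = density (lborel \<Otimes>\<^sub>M lborel) (\<lambda>p. ennreal (exp (- (cmod (case p of (x,y) \<Rightarrow> Complex x y))\<^sup>2 / v) / (pi * v)))"
    using v by (intro density_cong)
      (auto simp: normal_density_0 ennreal_mult[symmetric] exp_add[symmetric] cmod_power2
        diff_divide_distrib)
  finally show ?thesis
    using v unfolding cgauss_def
    by (simp add: lborel_complex, subst density_distr) auto
qed

lemma sets_cgauss [simp, measurable_cong]: "sets (cgauss v) = sets borel"
  by (simp add: cgauss_def)

lemma space_cgauss [simp]: "space (cgauss v) = UNIV"
  by (simp add: cgauss_def)

lemma nn_integral_cgauss_exp:
  assumes "v > 0" "t < 1 / v"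
  shows "(\<integral>\<^sup>+z. ennreal (exp (t * (cmod z)\<^sup>2)) \<partial>cgauss v) = ennreal (1 / (1 - t * v))"
proof -
  have tv: "1 - t * v > 0" using assms by (simp add: field_simps)
  have "(\<integral>\<^sup>+z. ennreal (exp (t * (cmod z)\<^sup>2)) \<partial>cgauss v)
    = (\<integral>\<^sup>+z. ennreal (1 / (pi * v)) * ennreal (exp (- (1 / v - t) * (cmod z)\<^sup>2 + Re (0 * z))) \<partial>lborel)"
    using assms unfolding cgauss_eq_density[OF assms(1)]
    by (subst nn_integral_density)
       (auto intro!: nn_integral_cong simp: ennreal_mult[symmetric] exp_add[symmetric] exp_diff exp_minus field_simps)
  also have "\<dots> = ennreal (1 / (pi * v)) * ennreal (pi / (1 / v - t))"
    using nn_integral_complex_gauss[of "1 / v - t" 0] assms by (simp add: nn_integral_cmult)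
  also have "\<dots> = ennreal (1 / (1 - t * v))"
    using assms tv by (subst ennreal_mult[symmetric]) (auto simp: field_simps)
  finally show ?thesis .
qed

lemma prob_space_cgauss:
  assumes "v \<ge> 0"
  shows "prob_space (cgauss v)"
proof (cases "v = 0")
  case True
  then show ?thesis by (simp add: cgauss_def prob_space_return)
next
  case False
  then have "emeasure (cgauss v) (space (cgauss v)) = 1"
    using nn_integral_cgauss_exp[of v 0] assms by simp
  then show ?thesis by (rule prob_spaceI)
qed

lemma distr_cgauss_uminus:
  assumes "v \<ge> 0"
  shows "distr (cgauss v) borel uminus = cgauss v"
proof (cases "v = 0")
  case True
  then show ?thesis by (simp add: cgauss_def distr_return)
next
  case False
  have lb: "(lborel :: complex measure) = distr lborel borel uminus"
    using lborel_affine[of "-1" "0::complex"] by (simp add: density_1)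
  have "distr (density lborel (\<lambda>z. ennreal (exp (- (cmod (- z))\<^sup>2 / v) / (pi * v)))) borel uminus
    = density (distr lborel borel uminus) (\<lambda>z::complex. ennreal (exp (- (cmod z)\<^sup>2 / v) / (pi * v)))"
    by (subst density_distr) auto
  then show ?thesis
    using cgauss_eq_density[of v] False assms by (simp add: lb[symmetric])
qed

lemma integral_cgauss_mean:
  assumes "v \<ge> 0"
  shows "(\<integral>z. z \<partial>cgauss v) = 0"
proof -
  have "(\<integral>z. z \<partial>cgauss v) = (\<integral>z. z \<partial>distr (cgauss v) borel uminus)"
    by (simp add: distr_cgauss_uminus assms)
  also have "\<dots> = (\<integral>z. - z \<partial>cgauss v)"
    by (subst integral_distr) auto
  finally show ?thesis by simp
qed

lemma nn_integral_cgauss_second_moment: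
  assumes "v \<ge> 0"
  shows "(\<integral>\<^sup>+z. ennreal ((cmod z)\<^sup>2) \<partial>cgauss v) = ennreal v"
proof (cases "v = 0")
  case True
  then show ?thesis by (simp add: cgauss_def nn_integral_return)
next
  case False
  with assms have v: "v > 0" by simp
  let ?N = "density lborel (normal_density 0 (sqrt (v/2)))"
  have m[measurable]: "(\<lambda>(x::real, y::real). Complex x y) \<in> ?N \<Otimes>\<^sub>M ?N \<rightarrow>\<^sub>M borel" 
    unfolding case_prod_beta by measurable
  interpret N: prob_space ?N
    using v by (intro prob_space_normal_density) auto
  have "(\<integral>\<^sup>+x. ennreal (x\<^sup>2) \<partial>?N) = (\<integral>\<^sup>+x. ennreal (normal_density 0 (sqrt (v/2)) x * (x - 0) ^ (2 * 1)) \<partial>lborel)"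
    by (subst nn_integral_density) (auto simp: ennreal_mult)
  also have "\<dots> = ennreal (\<integral>x. normal_density 0 (sqrt (v/2)) x * (x - 0) ^ (2 * 1) \<partial>lborel)"
    using v by (intro nn_integral_eq_integral integrable_normal_moment) auto
  also have "\<dots> = ennreal (v / 2)"
    using v by (subst integral_normal_moment_even) auto
  finally have c: "(\<integral>\<^sup>+x. ennreal (x\<^sup>2) \<partial>?N) = ennreal (v / 2)" .
  have "(\<integral>\<^sup>+z. ennreal ((cmod z)\<^sup>2) \<partial>cgauss v) = (\<integral>\<^sup>+(x, y). ennreal (x\<^sup>2) + ennreal (y\<^sup>2) \<partial>(?N \<Otimes>\<^sub>M ?N))"
    using v unfolding cgauss_def
    by (simp add: nn_integral_distr cmod_power2 case_prod_beta')
  also have "\<dots> = (\<integral>\<^sup>+x. ennreal (x\<^sup>2) + ennreal (v / 2) \<partial>?N)"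
    by (subst N.nn_integral_fst[symmetric])
       (auto simp: nn_integral_add c N.emeasure_space_1[simplified] simp del: nn_integral_density)
  also have "\<dots> = ennreal v"
    using v by (subst nn_integral_add) (auto simp: c N.emeasure_space_1[simplified] ennreal_plus[symmetric] simp del: ennreal_plus)
  finally show ?thesis .
qed

text \<open>With t = 1 / (2 \<omega>^2) the product t v is at most 1/2, so 1 / (1 - t v) is at most
  2. The weight is kept apart from the variance so that dividing by it also makes sense when v =
  0.\<close>

lemma nn_integral_cgauss_exp_le:
  assumes "v \<ge> 0" "v \<le> \<omega>\<^sup>2" "\<omega> > 0"
  shows "(\<integral>\<^sup>+z. ennreal (exp ((cmod z)\<^sup>2 / (2 * \<omega>\<^sup>2))) \<partial>cgauss v) \<le> ennreal 2"
proof (cases "v = 0")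
  case True
  then show ?thesis by (simp add: cgauss_def nn_integral_return)
next
  case False
  with assms have v: "v > 0" by simp
  have "1 / (2 * \<omega>\<^sup>2) * v \<le> 1 / 2" using assms by (simp add: field_simps)
  moreover from this have "1 / (2 * \<omega>\<^sup>2) < 1 / v" using v by (simp add: field_simps)
  ultimately show ?thesis
    using nn_integral_cgauss_exp[OF v, of "1 / (2 * \<omega>\<^sup>2)"]
    by (auto intro!: ennreal_leI simp: divide_le_eq simp del: ennreal_numeral)
qed

section \<open>Concentration of Gaussian Gram matrices\<close>

text \<open>For u \<ge> 0 apply e^u - 1 \<le> u e^u twice. For u < 0 compare e^u (1 - u) \<le> 1
  with (1 + u + u^2) (1 - u) = 1 - u^3 \<ge> 1. The linear term is isolated because it vanishes in
  expectation for centred variables.\<close>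

lemma exp_le_quadratic: "exp u \<le> 1 + u + u\<^sup>2 * exp \<bar>u\<bar>" for u :: real
proof (cases "u \<ge> 0")
  case True
  have 1: "exp u - 1 \<le> u * exp u"
  proof -
    have "1 - u \<le> exp (- u)" using exp_ge_add_one_self[of "- u"] by simp
    then have "(1 - u) * exp u \<le> exp (- u) * exp u" by (intro mult_right_mono) auto
    then show ?thesis by (simp add: exp_minus field_simps)
  qed
  then have "u * (exp u - 1) \<le> u * (u * exp u)" using True by (intro mult_left_mono)
  with 1 True show ?thesis by (simp add: power2_eq_square algebra_simps)
next
  case False
  have "1 - u \<le> exp (- u)" using exp_ge_add_one_self[of "- u"] by simp
  then have "exp u * (1 - u) \<le> exp u * exp (- u)" by (intro mult_left_mono) auto
  then have "exp u * (1 - u) \<le> 1" by (simp add: exp_minus)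
  also have "1 \<le> (1 + u + u\<^sup>2) * (1 - u)"
  proof -
    have "(1 + u + u\<^sup>2) * (1 - u) = 1 - u * u\<^sup>2" by (simp add: algebra_simps power2_eq_square)
    moreover have "u * u\<^sup>2 \<le> 0" using False by (intro mult_nonpos_nonneg) auto
    ultimately show ?thesis by linarith
  qed
  finally have "exp u \<le> 1 + u + u\<^sup>2" using False by (subst (asm) mult_le_cancel_right) auto
  also have "u\<^sup>2 \<le> u\<^sup>2 * exp \<bar>u\<bar>" by (intro mult_right_le_one_le[THEN le_imp_neg_le, simplified] mult_left_mono[of 1 _ "u\<^sup>2", simplified]) auto
  finally show ?thesis by simp
qed

lemma exp_midpoint_le: "exp ((a + b) / 2) \<le> (exp a + exp b) / 2" for a b :: real
proof -
  have "0 \<le> (exp (a / 2) - exp (b / 2))\<^sup>2" by simp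
  also have "\<dots> = exp a + exp b - 2 * exp ((a + b) / 2)"
    by (simp add: power2_diff exp_double[symmetric] exp_add add_divide_distrib)
  finally show ?thesis by simp
qed

lemma
  fixes f :: "'a \<Rightarrow> real"
  assumes [measurable]: "f \<in> borel_measurable M" and "\<And>x. 0 \<le> f x" "0 \<le> C"
    and le: "(\<integral>\<^sup>+x. ennreal (f x) \<partial>M) \<le> ennreal C"
  shows integrable_of_nn_integral_le: "integrable M f"
    and integral_le_of_nn_integral_le: "integral\<^sup>L M f \<le> C"
proof -
  have "(\<integral>\<^sup>+x. ennreal (f x) \<partial>M) < \<infinity>" using le by (rule le_less_trans) simp
  then show i: "integrable M f" using assms(2) by (intro integrableI_nonneg) auto
  have "ennreal (integral\<^sup>L M f) \<le> ennreal C"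
    using le assms(2) by (subst nn_integral_eq_integral[OF i, symmetric]) auto
  then show "integral\<^sup>L M f \<le> C" using assms(3) by (subst (asm) ennreal_le_iff) auto
qed

context prob_space
begin

text \<open>A centred product of two subgaussian variables is subexponential: in the quadratic bound
  for exp the linear term has mean 0, and the remainder is dominated by 64 s^2 W with W of mean at
  most 2, whence 128. The case x = y is covered, so the same bound serves the diagonal of the Gram
  matrix.\<close>

lemma nn_integral_exp_product_le:
  fixes x y :: "'a \<Rightarrow> complex" and c \<mu> :: complex and s :: real
  defines "X \<equiv> \<lambda>\<omega>. Re (c * (x \<omega> * cnj (y \<omega>) - \<mu>))"
  assumes [measurable]: "random_variable borel x" "random_variable borel y"
    and x: "(\<integral>\<^sup>+\<omega>. ennreal (exp ((cmod (x \<omega>))\<^sup>2 / 2)) \<partial>M) \<le> ennreal 2"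
    and y: "(\<integral>\<^sup>+\<omega>. ennreal (exp ((cmod (y \<omega>))\<^sup>2 / 2)) \<partial>M) \<le> ennreal 2"
    and c: "cmod c \<le> 1" and \<mu>: "cmod \<mu> \<le> 1" and mean: "expectation X = 0"
    and s: "0 \<le> s" "s \<le> 1 / 4"
  shows "(\<integral>\<^sup>+\<omega>. ennreal (exp (s * X \<omega>)) \<partial>M) \<le> ennreal (exp (128 * s\<^sup>2))"
proof -
  have X_meas[measurable]: "random_variable borel X" unfolding X_def by measurable
  define ex where "ex = (\<lambda>\<omega>. exp ((cmod (x \<omega>))\<^sup>2 / 2))"
  define ey where "ey = (\<lambda>\<omega>. exp ((cmod (y \<omega>))\<^sup>2 / 2))"
  define W where "W = (\<lambda>\<omega>. (ex \<omega> + ey \<omega>) / 2)"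
  have [measurable]: "random_variable borel ex" "random_variable borel ey" 
    unfolding ex_def ey_def by measurable
  have ix: "integrable M ex" "expectation ex \<le> 2" and iy: "integrable M ey" "expectation ey \<le> 2"
    using x y unfolding ex_def ey_def
    by (auto intro!: integral_le_of_nn_integral_le integrable_of_nn_integral_le[where C = 2])
  have iW: "integrable M W" "expectation W \<le> 2"
    using ix iy by (auto simp: W_def)
  \<comment> \<open>Here |X| is at most 1 + (|x|^2 + |y|^2) / 2. Halving leaves e^(1/2) \<le> 2
    times the exponential of a midpoint, which convexity bounds by W.\<close>
  have Xe: "exp (\<bar>X \<omega>\<bar> / 2) \<le> 2 * W \<omega>" for \<omega>
  proof -
    have "\<bar>X \<omega>\<bar> \<le> cmod (c * (x \<omega> * cnj (y \<omega>) - \<mu>))" unfolding X_def by (rule abs_Re_le_cmod)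
    also have "\<dots> \<le> 1 * (cmod (x \<omega> * cnj (y \<omega>)) + cmod \<mu>)"
      unfolding norm_mult[of c] by (intro mult_mono c norm_triangle_ineq4) auto
    also have "\<dots> \<le> cmod (x \<omega>) * cmod (y \<omega>) + 1" using \<mu> by (simp add: norm_mult)
    also have "cmod (x \<omega>) * cmod (y \<omega>) \<le> ((cmod (x \<omega>))\<^sup>2 + (cmod (y \<omega>))\<^sup>2) / 2"
      using sum_squares_bound[of "cmod (x \<omega>)" "cmod (y \<omega>)"] by simp
    finally have "\<bar>X \<omega>\<bar> / 2 \<le> 1 / 2 + ((cmod (x \<omega>))\<^sup>2 / 2 + (cmod (y \<omega>))\<^sup>2 / 2) / 2" by simp
    then have "exp (\<bar>X \<omega>\<bar> / 2) \<le> exp (1 / 2 + ((cmod (x \<omega>))\<^sup>2 / 2 + (cmod (y \<omega>))\<^sup>2 / 2) / 2)" by simp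
    also have "\<dots> = exp (1 / 2) * exp (((cmod (x \<omega>))\<^sup>2 / 2 + (cmod (y \<omega>))\<^sup>2 / 2) / 2)" by (rule exp_add)
    also have "\<dots> \<le> 2 * W \<omega>"
      unfolding W_def ex_def ey_def by (intro mult_mono exp_half_le_2 exp_midpoint_le) auto
    finally show ?thesis .
  qed
  have iX: "integrable M X"
  proof (rule Bochner_Integration.integrable_bound)
    show "integrable M (\<lambda>\<omega>. 4 * W \<omega>)" using iW by simp
    have "\<bar>X \<omega>\<bar> \<le> 4 * W \<omega>" for \<omega>
      using exp_ge_add_one_self[of "\<bar>X \<omega>\<bar> / 2"] Xe[of \<omega>] by linarith
    then show "AE \<omega> in M. norm (X \<omega>) \<le> norm (4 * W \<omega>)"
      by (auto intro!: AE_I2 intro: order_trans abs_ge_self)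
  qed measurable
  have bound: "exp (s * X \<omega>) \<le> 1 + s * X \<omega> + 64 * s\<^sup>2 * W \<omega>" for \<omega>
  proof -
    \<comment> \<open>The quadratic Taylor term of exp at |X| / 4 gives the 32. As s is at most 1/4,
      the factor exp |s X| costs another exp (|X| / 4), and the two together amount to exp (|X| /
      2), for which \<open>Xe\<close> is available.\<close>
    have sq: "(X \<omega>)\<^sup>2 \<le> 32 * exp (\<bar>X \<omega>\<bar> / 4)"
      using exp_lower_Taylor_quadratic[of "\<bar>X \<omega>\<bar> / 4"] by (simp add: power_divide)
    have "(s * X \<omega>)\<^sup>2 * exp \<bar>s * X \<omega>\<bar> \<le> s\<^sup>2 * ((32 * exp (\<bar>X \<omega>\<bar> / 4)) * exp (\<bar>X \<omega>\<bar> / 4))"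
    proof -
      have "\<bar>s * X \<omega>\<bar> \<le> \<bar>X \<omega>\<bar> / 4" using s mult_right_mono[of s "1 / 4" "\<bar>X \<omega>\<bar>"] by (simp add: abs_mult)
      then show ?thesis
        unfolding power_mult_distrib mult.assoc[of "s\<^sup>2"] by (intro mult_left_mono mult_mono sq) auto
    qed
    also have "\<dots> = 32 * s\<^sup>2 * exp (\<bar>X \<omega>\<bar> / 2)"
      by (simp add: exp_add[symmetric])
    also have "\<dots> \<le> 32 * s\<^sup>2 * (2 * W \<omega>)" by (intro mult_left_mono Xe) auto
    finally show ?thesis using exp_le_quadratic[of "s * X \<omega>"] by simp
  qed
  have "(\<integral>\<^sup>+\<omega>. ennreal (exp (s * X \<omega>)) \<partial>M) \<le> (\<integral>\<^sup>+\<omega>. ennreal (1 + s * X \<omega> + 64 * s\<^sup>2 * W \<omega>) \<partial>M)"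
    by (intro nn_integral_mono ennreal_leI bound)
  also have "\<dots> = ennreal (expectation (\<lambda>\<omega>. 1 + s * X \<omega> + 64 * s\<^sup>2 * W \<omega>))"
    using iX iW bound by (intro nn_integral_eq_integral) (auto intro!: AE_I2 intro: order_trans[OF exp_ge_zero])
  also have "expectation (\<lambda>\<omega>. 1 + s * X \<omega> + 64 * s\<^sup>2 * W \<omega>) = 1 + 64 * s\<^sup>2 * expectation W"
    using iX iW by (simp add: mean prob_space)
  also have "ennreal \<dots> \<le> ennreal (exp (128 * s\<^sup>2))"
  proof (rule ennreal_leI)
    have "1 + 64 * s\<^sup>2 * expectation W \<le> 1 + 64 * s\<^sup>2 * 2"
      using iW by (intro add_left_mono mult_left_mono) auto
    then show "1 + 64 * s\<^sup>2 * expectation W \<le> exp (128 * s\<^sup>2)"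
      using exp_ge_add_one_self[of "128 * s\<^sup>2"] by linarith
  qed
  finally show ?thesis .
qed

text \<open>Chernoff bound: the indicator of the tail is at most exp (s (sum - t)), whose
  expectation factors by independence.\<close>

lemma indep_sum_exp_tail:
  fixes X :: "'i \<Rightarrow> 'a \<Rightarrow> real"
  assumes I: "finite I" "indep_vars (\<lambda>_. borel) X I" and s: "s > 0"
    and mgf: "\<And>i. i \<in> I \<Longrightarrow> (\<integral>\<^sup>+\<omega>. ennreal (exp (s * X i \<omega>)) \<partial>M) \<le> ennreal (exp b)"
  shows "prob {\<omega>\<in>space M. t \<le> (\<Sum>i\<in>I. X i \<omega>)} \<le> exp (real (card I) * b - s * t)"
proof -
  have rv[measurable]: "i \<in> I \<Longrightarrow> random_variable borel (X i)" for i
    using I(2) by (auto simp: indep_vars_def)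
  have "indep_vars (\<lambda>_. borel) (\<lambda>i \<omega>. ennreal (exp (s * X i \<omega>))) I"
    by (rule indep_vars_compose2[OF I(2)]) measurable
  then have E: "(\<integral>\<^sup>+\<omega>. (\<Prod>i\<in>I. ennreal (exp (s * X i \<omega>))) \<partial>M) = (\<Prod>i\<in>I. \<integral>\<^sup>+\<omega>. ennreal (exp (s * X i \<omega>)) \<partial>M)"
    by (intro indep_vars_nn_integral I) auto
  have "ennreal (prob {\<omega>\<in>space M. t \<le> (\<Sum>i\<in>I. X i \<omega>)}) = emeasure M {\<omega>\<in>space M. t \<le> (\<Sum>i\<in>I. X i \<omega>)}"
    by (simp add: emeasure_eq_measure)
  also have "\<dots> \<le> (\<integral>\<^sup>+\<omega>. ennreal (exp (- s * t)) * (\<Prod>i\<in>I. ennreal (exp (s * X i \<omega>))) \<partial>M)"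
  proof (subst nn_integral_indicator[symmetric])
    show "(\<integral>\<^sup>+\<omega>. indicator {\<omega>\<in>space M. t \<le> (\<Sum>i\<in>I. X i \<omega>)} \<omega> \<partial>M)
      \<le> (\<integral>\<^sup>+\<omega>. ennreal (exp (- s * t)) * (\<Prod>i\<in>I. ennreal (exp (s * X i \<omega>))) \<partial>M)"
    proof (rule nn_integral_mono)
      fix \<omega>
      have eq: "ennreal (exp (- s * t)) * (\<Prod>i\<in>I. ennreal (exp (s * X i \<omega>))) = ennreal (exp (s * ((\<Sum>i\<in>I. X i \<omega>) - t)))"
        using I(1) by (simp add: prod_ennreal exp_sum[symmetric] ennreal_mult[symmetric] exp_add[symmetric]
            sum_distrib_left algebra_simps)
      show "indicator {\<omega>\<in>space M. t \<le> (\<Sum>i\<in>I. X i \<omega>)} \<omega> \<le> ennreal (exp (- s * t)) * (\<Prod>i\<in>I. ennreal (exp (s * X i \<omega>)))"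
        unfolding eq using s by (auto simp: indicator_def)
    qed
  qed measurable
  also have "\<dots> = ennreal (exp (- s * t)) * (\<Prod>i\<in>I. \<integral>\<^sup>+\<omega>. ennreal (exp (s * X i \<omega>)) \<partial>M)"
    by (subst nn_integral_cmult) (auto simp: E)
  also have "\<dots> \<le> ennreal (exp (- s * t)) * (\<Prod>i\<in>I. ennreal (exp b))"
    by (intro mult_left_mono prod_mono_ennreal mgf) auto
  also have "\<dots> = ennreal (exp (real (card I) * b - s * t))"
    by (simp add: ennreal_power ennreal_mult[symmetric] exp_of_nat_mult[symmetric] exp_add[symmetric])
  finally show ?thesis by (subst (asm) ennreal_le_iff) auto
qed

lemma cgauss_law_moments:
  assumes [measurable]: "random_variable borel G" and law: "distr M borel G = cgauss v" and v: "v \<ge> 0"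
  shows "expectation G = 0" "integrable M G"
    "integrable M (\<lambda>\<omega>. (cmod (G \<omega>))\<^sup>2)" "expectation (\<lambda>\<omega>. (cmod (G \<omega>))\<^sup>2) = v"
proof -
  have "expectation G = (\<integral>z. z \<partial>distr M borel G)" by (subst integral_distr) auto
  then show "expectation G = 0" by (simp add: law integral_cgauss_mean v)
  have e: "(\<integral>\<^sup>+\<omega>. ennreal ((cmod (G \<omega>))\<^sup>2) \<partial>M) = ennreal v"
    unfolding nn_integral_cgauss_second_moment[OF v, symmetric] law[symmetric]
    by (subst nn_integral_distr) auto
  then show i: "integrable M (\<lambda>\<omega>. (cmod (G \<omega>))\<^sup>2)"
    by (intro integrable_of_nn_integral_le[where C = v]) (auto simp: v)
  show "expectation (\<lambda>\<omega>. (cmod (G \<omega>))\<^sup>2) = v"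
    using e v by (subst (asm) nn_integral_eq_integral[OF i]) auto
  show "integrable M G"
  proof (rule Bochner_Integration.integrable_bound)
    show "integrable M (\<lambda>\<omega>. 1 + (cmod (G \<omega>))\<^sup>2)" using i by simp
    have "t \<le> 1 + t\<^sup>2" for t :: real using sum_squares_bound[of t 1] by (simp add: power2_eq_square) (smt (verit) zero_le_square)
    then show "AE \<omega> in M. norm (G \<omega>) \<le> norm (1 + (cmod (G \<omega>))\<^sup>2)"
      by (auto intro!: AE_I2 intro: order_trans abs_ge_self)
  qed measurable
qed

text \<open>Dividing by the weights brings diagonal and off-diagonal entries into the form of the
  centred product bound, and distinct columns m contribute independent summands. The threshold
  carries \<delta> / 2 because passing from the modulus to a quarter turn loses a factor 2.\<close>

lemma gram_entry_tail:
  fixes G :: "'p \<Rightarrow> nat \<Rightarrow> 'a \<Rightarrow> complex" and v \<omega> :: "'p \<Rightarrow> real" and c :: complex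
  assumes indep: "indep_vars (\<lambda>_. borel) (\<lambda>(p, m). G p m) (P \<times> {..<n})"
    and law: "\<And>p m. p \<in> P \<Longrightarrow> m < n \<Longrightarrow> distr M borel (G p m) = cgauss (v p)"
    and v: "\<And>p. p \<in> P \<Longrightarrow> 0 \<le> v p \<and> v p \<le> (\<omega> p)\<^sup>2" and \<omega>: "\<And>p. p \<in> P \<Longrightarrow> \<omega> p > 0"
    and \<delta>: "0 < \<delta>" "\<delta> \<le> 1" and c: "cmod c \<le> 1" and pq: "p \<in> P" "q \<in> P"
  shows "prob {x\<in>space M. real n * \<delta> / 2 * (\<omega> p * \<omega> q) \<le>
      Re (c * ((\<Sum>m<n. G p m x * cnj (G q m x)) - of_nat n * of_real (if p = q then v p else 0)))}
    \<le> exp (- real n * \<delta>\<^sup>2 / 2048)"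
proof -
  define g where "g = (\<lambda>p m x. G p m x / complex_of_real (\<omega> p))"
  define \<mu> where "\<mu> = complex_of_real ((if p = q then v p else 0) / (\<omega> p * \<omega> q))"
  define X where "X = (\<lambda>m x. Re (c * (g p m x * cnj (g q m x) - \<mu>)))"
  have pos: "\<omega> p > 0" "\<omega> q > 0" using \<omega> pq by auto
  have rvG: "random_variable borel (G r m)" if "r \<in> P" "m < n" for r m
    using indep that unfolding indep_vars_def by auto
  then have rvg: "random_variable borel (g r m)" if "r \<in> P" "m < n" for r m
    using that unfolding g_def by (intro borel_measurable_divide) auto
  have indepX: "indep_vars (\<lambda>_. borel) X {..<n}"
  proof -
    \<comment> \<open>The summand m depends only on the index block P \<times> {m}. These blocks are
      disjoint, so the summands are independent over m, also when p = q.\<close>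
    let ?r = "\<lambda>m x. restrict (\<lambda>i. (case i of (p, m) \<Rightarrow> G p m) x) (P \<times> {m})"
    have i: "indep_vars (\<lambda>m. PiM (P \<times> {m}) (\<lambda>_. borel)) ?r {..<n}"
      by (rule indep_vars_restrict[OF indep]) (auto simp: disjoint_family_on_def)
    have "indep_vars (\<lambda>_. borel) (\<lambda>m x. Re (c * ((?r m x) (p, m) / complex_of_real (\<omega> p) *
        cnj ((?r m x) (q, m) / complex_of_real (\<omega> q)) - \<mu>))) {..<n}"
    proof (rule indep_vars_compose2[OF i])
      fix m
      have [measurable]: "(\<lambda>h. h (r, m)) \<in> borel_measurable (PiM (P \<times> {m}) (\<lambda>_. borel))" if "r \<in> P" for r
        using that by (intro measurable_component_singleton) auto
      note [measurable] = this[OF pq(1)] this[OF pq(2)]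
      show "(\<lambda>h. Re (c * (h (p, m) / complex_of_real (\<omega> p) * cnj (h (q, m) / complex_of_real (\<omega> q)) - \<mu>)))
          \<in> borel_measurable (PiM (P \<times> {m}) (\<lambda>_. borel))"
        by measurable
    qed
    then show ?thesis using pq by (simp add: X_def g_def)
  qed
  have \<mu>1: "cmod \<mu> \<le> 1"
    using v[OF pq(1)] pos unfolding \<mu>_def norm_of_real by (auto simp: power2_eq_square)
  have expg: "(\<integral>\<^sup>+x. ennreal (exp ((cmod (g r m x))\<^sup>2 / 2)) \<partial>M) \<le> ennreal 2" if r: "r \<in> P" and m: "m < n" for r m
  proof -
    have "(\<integral>\<^sup>+x. ennreal (exp ((cmod (g r m x))\<^sup>2 / 2)) \<partial>M)
      = (\<integral>\<^sup>+z. ennreal (exp ((cmod z)\<^sup>2 / (2 * (\<omega> r)\<^sup>2))) \<partial>distr M borel (G r m))"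
      using rvG[OF r m] by (subst nn_integral_distr) (auto simp: g_def norm_divide power_divide mult.commute)
    then show ?thesis
      using nn_integral_cgauss_exp_le[of "v r" "\<omega> r"] v[OF r] \<omega>[OF r] by (simp add: law[OF r m])
  qed
  have mean: "expectation (X m) = 0" if m: "m < n" for m
  proof -
    note mp = cgauss_law_moments[OF rvG law, OF pq(1) m pq(1) m] 
      and mq = cgauss_law_moments[OF rvG law, OF pq(2) m pq(2) m] 
    \<comment> \<open>On the diagonal this is the second moment. Off it, independence factors the
      mean into two means, both 0.\<close>
    have E: "integrable M (\<lambda>x. G p m x * cnj (G q m x)) \<and>
      expectation (\<lambda>x. G p m x * cnj (G q m x)) = of_real (if p = q then v p else 0)"
    proof (cases "p = q")
      case True
      then show ?thesis
        using mp v[OF pq(1)] by (simp add: complex_norm_square[symmetric] del: of_real_power)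
    next
      case False
      let ?A = "{(p, m)}" and ?B = "{(q, m)}"
      let ?Y = "\<lambda>i. (case i of (p, m) \<Rightarrow> G p m)"
      have "indep_var (PiM ?A (\<lambda>_. borel)) (\<lambda>x. restrict (\<lambda>i. ?Y i x) ?A) (PiM ?B (\<lambda>_. borel)) (\<lambda>x. restrict (\<lambda>i. ?Y i x) ?B)"
        using False pq m by (intro indep_var_restrict[OF indep]) auto
      then have "indep_var borel ((\<lambda>h. h (p, m)) \<circ> (\<lambda>x. restrict (\<lambda>i. ?Y i x) ?A))
          borel ((\<lambda>h. cnj (h (q, m))) \<circ> (\<lambda>x. restrict (\<lambda>i. ?Y i x) ?B))"
        by (rule indep_var_compose) measurable
      then have iv: "indep_var borel (G p m) borel (\<lambda>x. cnj (G q m x))"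
        by (simp add: comp_def)
      have iq: "integrable M (\<lambda>x. cnj (G q m x))" using mq v[OF pq(2)] by simp
      show ?thesis
        using False indep_var_integrable[OF iv _ iq] indep_var_lebesgue_integral[OF iv _ iq] mp v[OF pq(1)] by simp
    qed
    have Xeq: "X m x = Re (c * (G p m x * cnj (G q m x) / of_real (\<omega> p * \<omega> q) - \<mu>))" for x
      by (simp add: X_def g_def)
    have "expectation (X m) = Re (expectation (\<lambda>x. c * (G p m x * cnj (G q m x) / of_real (\<omega> p * \<omega> q) - \<mu>)))"
      unfolding Xeq using E by (intro integral_Re) auto
    also have "\<dots> = Re (c * (expectation (\<lambda>x. G p m x * cnj (G q m x)) / of_real (\<omega> p * \<omega> q) - \<mu>))"
      using E by (simp add: prob_space)
    also have "\<dots> = 0" using E by (simp add: \<mu>_def)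
    finally show ?thesis .
  qed
  \<comment> \<open>\<open>\<delta> / 512\<close> minimises \<open>n (128 s\<^sup>2 - s \<delta> / 2)\<close>.\<close>
  have mgf: "(\<integral>\<^sup>+x. ennreal (exp (\<delta> / 512 * X m x)) \<partial>M) \<le> ennreal (exp (128 * (\<delta> / 512)\<^sup>2))" if m: "m < n" for m
    unfolding X_def
    by (rule nn_integral_exp_product_le)
       (use rvg expg pq m c \<mu>1 mean[OF m] \<delta> in \<open>auto simp: X_def\<close>)
  have "prob {x\<in>space M. real n * \<delta> / 2 \<le> (\<Sum>m<n. X m x)}
    \<le> exp (real (card {..<n}) * (128 * (\<delta> / 512)\<^sup>2) - \<delta> / 512 * (real n * \<delta> / 2))"
    using \<delta> by (intro indep_sum_exp_tail indepX mgf) auto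
  also have "\<dots> = exp (- real n * \<delta>\<^sup>2 / 2048)"
    by (simp add: power2_eq_square field_simps)
  also have "{x\<in>space M. real n * \<delta> / 2 \<le> (\<Sum>m<n. X m x)} =
    {x\<in>space M. real n * \<delta> / 2 * (\<omega> p * \<omega> q) \<le>
      Re (c * ((\<Sum>m<n. G p m x * cnj (G q m x)) - of_nat n * of_real (if p = q then v p else 0)))}"
  proof -
    have "(\<Sum>m<n. X m x) = Re (c * ((\<Sum>m<n. G p m x * cnj (G q m x)) - of_nat n * of_real (if p = q then v p else 0)))
        / (\<omega> p * \<omega> q)" for x
    proof -
      have "(\<Sum>m<n. X m x) = Re (\<Sum>m<n. c * (g p m x * cnj (g q m x) - \<mu>))" by (simp add: X_def)
      also have "(\<Sum>m<n. c * (g p m x * cnj (g q m x) - \<mu>)) = c * ((\<Sum>m<n. g p m x * cnj (g q m x)) - of_nat n * \<mu>)"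
        by (simp add: sum_distrib_left[symmetric] sum_subtractf)
      also have "(\<Sum>m<n. g p m x * cnj (g q m x)) = (\<Sum>m<n. G p m x * cnj (G q m x)) / of_real (\<omega> p * \<omega> q)"
        by (simp add: g_def sum_divide_distrib)
      also have "c * ((\<Sum>m<n. G p m x * cnj (G q m x)) / of_real (\<omega> p * \<omega> q) - of_nat n * \<mu>) =
        c * ((\<Sum>m<n. G p m x * cnj (G q m x)) - of_nat n * of_real (if p = q then v p else 0)) / of_real (\<omega> p * \<omega> q)"
        unfolding \<mu>_def of_real_divide by (simp only: times_divide_eq_right diff_divide_distrib[symmetric])
      finally show ?thesis by (simp only: Re_divide_of_real)
    qed
    then show ?thesis using pos by (simp add: pos_le_divide_eq)
  qed
  finally show ?thesis .
qed

text \<open>Union bound over all pairs (p, q) and the four quarter turns, whence the square of card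
  P and the factor 4.\<close>

lemma gram_deviation_prob:
  fixes G :: "'p \<Rightarrow> nat \<Rightarrow> 'a \<Rightarrow> complex" and v \<omega> :: "'p \<Rightarrow> real"
  assumes P: "finite P" and indep: "indep_vars (\<lambda>_. borel) (\<lambda>(p, m). G p m) (P \<times> {..<n})"
    and law: "\<And>p m. p \<in> P \<Longrightarrow> m < n \<Longrightarrow> distr M borel (G p m) = cgauss (v p)"
    and v: "\<And>p. p \<in> P \<Longrightarrow> 0 \<le> v p \<and> v p \<le> (\<omega> p)\<^sup>2" and \<omega>: "\<And>p. p \<in> P \<Longrightarrow> \<omega> p > 0"
    and \<delta>: "0 < \<delta>" "\<delta> \<le> 1"
  shows "prob {x\<in>space M. \<exists>p\<in>P. \<exists>q\<in>P. real n * \<delta> * (\<omega> p * \<omega> q) <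
      cmod ((\<Sum>m<n. G p m x * cnj (G q m x)) - of_nat n * of_real (if p = q then v p else 0))}
    \<le> 4 * (real (card P))\<^sup>2 * exp (- real n * \<delta>\<^sup>2 / 2048)"
proof -
  let ?C = "{1, -1, \<i>, -\<i>} :: complex set"
  define T where "T = (\<lambda>p q x. (\<Sum>m<n. G p m x * cnj (G q m x)) - of_nat n * of_real (if p = q then v p else 0))"
  define E where "E = (\<lambda>(p, q, c). {x\<in>space M. real n * \<delta> / 2 * (\<omega> p * \<omega> q) \<le> Re (c * T p q x)})"
  have rvG[measurable]: "random_variable borel (G r m)" if "r \<in> P" "m < n" for r m
    using indep that unfolding indep_vars_def by auto
  have rvT[measurable]: "random_variable borel (T p q)" if "p \<in> P" "q \<in> P" for p q
    using that unfolding T_def by measurable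
  have Em: "E i \<in> events" if "i \<in> P \<times> P \<times> ?C" for i
    using that unfolding E_def by (cases i) (clarify, measurable)
  have "prob {x\<in>space M. \<exists>p\<in>P. \<exists>q\<in>P. real n * \<delta> * (\<omega> p * \<omega> q) < cmod (T p q x)}
    \<le> prob (\<Union>i\<in>P \<times> P \<times> ?C. E i)"
  proof (rule finite_measure_mono)
    show "{x\<in>space M. \<exists>p\<in>P. \<exists>q\<in>P. real n * \<delta> * (\<omega> p * \<omega> q) < cmod (T p q x)} \<subseteq> (\<Union>i\<in>P \<times> P \<times> ?C. E i)"
    proof safe
      fix x p q
      assume x: "x \<in> space M" and pq: "p \<in> P" "q \<in> P" and lt: "real n * \<delta> * (\<omega> p * \<omega> q) < cmod (T p q x)"
      obtain c where c: "c \<in> ?C" and "cmod (T p q x) / 2 \<le> Re (c * T p q x)"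
        using exists_quarter_turn by blast
      moreover have "real n * \<delta> / 2 * (\<omega> p * \<omega> q) \<le> cmod (T p q x) / 2" using lt by simp
      ultimately have "real n * \<delta> / 2 * (\<omega> p * \<omega> q) \<le> Re (c * T p q x)" by linarith
      then have "x \<in> E (p, q, c)" using x by (simp only: E_def prod.case mem_Collect_eq)
      with c show "x \<in> (\<Union>i\<in>P \<times> P \<times> ?C. E i)" using pq by blast
    qed
    show "(\<Union>i\<in>P \<times> P \<times> ?C. E i) \<in> events" using P Em by (intro sets.finite_UN) auto
  qed
  also have "\<dots> \<le> (\<Sum>i\<in>P \<times> P \<times> ?C. prob (E i))"
    using P Em by (intro finite_measure_subadditive_finite) auto
  also have "\<dots> \<le> (\<Sum>i\<in>P \<times> P \<times> ?C. exp (- real n * \<delta>\<^sup>2 / 2048))"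
  proof (rule sum_mono)
    fix i assume "i \<in> P \<times> P \<times> ?C"
    then obtain p q c where i: "i = (p, q, c)" "p \<in> P" "q \<in> P" "cmod c \<le> 1" by auto
    show "prob (E i) \<le> exp (- real n * \<delta>\<^sup>2 / 2048)"
      using gram_entry_tail[OF indep law v \<omega> \<delta> i(4,2,3)] by (simp add: i(1) E_def T_def)
  qed
  also have "\<dots> = 4 * (real (card P))\<^sup>2 * exp (- real n * \<delta>\<^sup>2 / 2048)"
  proof -
    have "card ?C = 4" by (simp add: complex_eq_iff)
    then show ?thesis by (simp add: card_cartesian_product power2_eq_square)
  qed
  finally show ?thesis by (simp add: T_def)
qed

end

section \<open>Correlations on the complex sphere\<close>

definition sqnorm :: "nat \<Rightarrow> (nat \<Rightarrow> complex) \<Rightarrow> real" where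
  "sqnorm D x = (\<Sum>i<D. (cmod (x i))\<^sup>2)"

text \<open>Conjugate-linear in the first argument, so that \<open>cip D (A k) y\<close> is the
  projection of y appearing in the statistic of index k.\<close>

definition cip :: "nat \<Rightarrow> (nat \<Rightarrow> complex) \<Rightarrow> (nat \<Rightarrow> complex) \<Rightarrow> complex" where
  "cip D a b = (\<Sum>i<D. cnj (a i) * b i)"

lemma cvec_norm_square: "(cvec_norm D x)\<^sup>2 = sqnorm D x"
  by (simp add: cvec_norm_def sqnorm_def sum_nonneg)

lemma sqnorm_nonneg: "0 \<le> sqnorm D x"
  by (simp add: sqnorm_def sum_nonneg)

lemma sqnorm_scale:
  "sqnorm D (\<lambda>i\<in>{..<D}. complex_of_real r * x i) = r\<^sup>2 * sqnorm D x"
  by (simp add: sqnorm_def norm_mult power_mult_distrib sum_distrib_left)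

lemma cip_scale:
  "cip D (\<lambda>i\<in>{..<D}. complex_of_real r * x i) b = of_real r * cip D x b"
  by (simp add: cip_def sum_distrib_left ac_simps)

lemma space_lebesgue_CD: "space (lebesgue_CD D) = extensional {..<D}"
  by (auto simp: lebesgue_CD_def space_PiM PiE_def)

lemma sets_lebesgue_CD [measurable_cong]: "sets (lebesgue_CD D) = sets (PiM {..<D} (\<lambda>_. borel))"
  unfolding lebesgue_CD_def by (intro sets_PiM_cong) auto

lemma measurable_component_complex:
  "i < D \<Longrightarrow> (\<lambda>x. x i :: complex) \<in> borel_measurable (PiM {..<D} (\<lambda>_. borel))"
  by (intro measurable_component_singleton) auto

lemma measurable_sqnorm [measurable]: "sqnorm D \<in> borel_measurable (PiM {..<D} (\<lambda>_. borel))"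
proof -
  have "(\<lambda>x. \<Sum>i<D. (cmod (x i))\<^sup>2) \<in> borel_measurable (PiM {..<D} (\<lambda>_. borel))"
    by (intro borel_measurable_sum borel_measurable_power borel_measurable_norm measurable_component_complex) auto
  then show ?thesis by (simp add: sqnorm_def[abs_def])
qed

lemma measurable_cip_left [measurable]: "(\<lambda>x. cip D x b) \<in> borel_measurable (PiM {..<D} (\<lambda>_. borel))"
proof -
  have "(\<lambda>x. \<Sum>i<D. cnj (x i) * b i) \<in> borel_measurable (PiM {..<D} (\<lambda>_. borel))"
    by (intro borel_measurable_sum borel_measurable_times measurable_compose[OF _ measurable_cnj] measurable_component_complex) auto
  then show ?thesis by (simp add: cip_def[abs_def])
qed

lemma measurable_scale [measurable]:
  "(\<lambda>x. \<lambda>i\<in>{..<D}. complex_of_real r * x i) \<in> PiM {..<D} (\<lambda>_. borel) \<rightarrow>\<^sub>M PiM {..<D} (\<lambda>_. borel)"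
  by (intro measurable_restrict borel_measurable_times measurable_component_complex) auto

lemma sigma_finite_lebesgue_CD: "sigma_finite_measure (lebesgue_CD D)"
proof -
  interpret product_sigma_finite "\<lambda>_::nat. lborel :: complex measure" ..
  show ?thesis unfolding lebesgue_CD_def by (intro sigma_finite) auto
qed

section \<open>Dilations and Gaussian integrals for Lebesgue measure on C^D\<close>

lemma emeasure_lborel_complex_scale:
  assumes "r > 0" "A \<in> sets borel"
  shows "emeasure lborel A = ennreal (r\<^sup>2) * emeasure lborel ((\<lambda>z. complex_of_real r * z) -` A)"
proof -
  have "emeasure lborel A = emeasure (density (distr lborel borel (\<lambda>x. 0 + r *\<^sub>R x)) (\<lambda>_. ennreal (\<bar>r\<bar> ^ DIM(complex)))) A"
    using assms by (subst lborel_affine[of r "0::complex", symmetric]) auto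
  also have "\<dots> = ennreal (r\<^sup>2) * emeasure (distr lborel borel (\<lambda>x. r *\<^sub>R x :: complex)) A"
    using assms by (simp add: emeasure_density_const)
  also have "emeasure (distr lborel borel (\<lambda>x. r *\<^sub>R x :: complex)) A = emeasure lborel ((\<lambda>z. complex_of_real r * z) -` A)"
    using assms by (subst emeasure_distr) (auto simp: scaleR_conv_of_real[abs_def])
  finally show ?thesis .
qed

text \<open>A complex coordinate has real dimension 2, hence the Jacobian r^(2 D). Equality of
  measures is tested on product sets, where it splits into one scaling identity per
  coordinate.\<close>

lemma lebesgue_CD_scale:
  assumes r: "r > 0"
  shows "scale_measure (ennreal (r ^ (2 * D)))
    (distr (lebesgue_CD D) (PiM {..<D} (\<lambda>_. borel)) (\<lambda>x. \<lambda>i\<in>{..<D}. complex_of_real r * x i)) = lebesgue_CD D"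
proof -
  interpret product_sigma_finite "\<lambda>_::nat. lborel :: complex measure" ..
  let ?T = "\<lambda>x. \<lambda>i\<in>{..<D}. complex_of_real r * x i"
  show ?thesis
    unfolding lebesgue_CD_def
  proof (rule PiM_eqI)
    fix A :: "nat \<Rightarrow> complex set"
    assume A: "\<And>i. i \<in> {..<D} \<Longrightarrow> A i \<in> sets lborel"
    have m: "?T \<in> PiM {..<D} (\<lambda>_. lborel) \<rightarrow>\<^sub>M PiM {..<D} (\<lambda>_. borel)"
      using measurable_scale[of D r] measurable_cong_sets[OF sets_PiM_cong[OF refl, of "{..<D}" "\<lambda>_. lborel" "\<lambda>_. borel"]]
      by auto
    have AE: "Pi\<^sub>E {..<D} A \<in> sets (PiM {..<D} (\<lambda>_. borel))"
      using A by (intro sets_PiM_I_finite) auto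
    have "?T -` Pi\<^sub>E {..<D} A \<inter> space (PiM {..<D} (\<lambda>_. lborel)) = Pi\<^sub>E {..<D} (\<lambda>i. (\<lambda>z. complex_of_real r * z) -` A i)"
      by (auto simp: space_PiM PiE_def Pi_def)
    then have "emeasure (scale_measure (ennreal (r ^ (2 * D))) (distr (PiM {..<D} (\<lambda>_. lborel)) (PiM {..<D} (\<lambda>_. borel)) ?T)) (Pi\<^sub>E {..<D} A)
      = ennreal (r ^ (2 * D)) * (\<Prod>i<D. emeasure lborel ((\<lambda>z. complex_of_real r * z) -` A i))"
      using A by (simp add: emeasure_distr[OF m AE], subst emeasure_PiM)
         (auto intro!: measurable_sets[of "\<lambda>z. complex_of_real r * z" borel borel, simplified])
    also have "\<dots> = (\<Prod>i<D. ennreal (r\<^sup>2) * emeasure lborel ((\<lambda>z. complex_of_real r * z) -` A i))"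
      using r by (simp add: prod.distrib ennreal_power power_mult)
    also have "\<dots> = (\<Prod>i<D. emeasure lborel (A i))"
      using A r by (intro prod.cong refl emeasure_lborel_complex_scale[symmetric]) auto
    finally show "emeasure (scale_measure (ennreal (r ^ (2 * D))) (distr (PiM {..<D} (\<lambda>_. lborel)) (PiM {..<D} (\<lambda>_. borel)) ?T)) (Pi\<^sub>E {..<D} A)
      = (\<Prod>i<D. emeasure lborel (A i))" .
  qed (auto intro!: sets_PiM_cong)
qed

lemma nn_integral_lebesgue_CD_gauss:
  fixes a :: real
  assumes a: "a > 0"
  shows "(\<integral>\<^sup>+x. ennreal (exp (- a * sqnorm D x + Re (\<Sum>i<D. w i * x i))) \<partial>lebesgue_CD D)
    = ennreal ((pi / a) ^ D * exp (sqnorm D w / (4 * a)))"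
proof -
  interpret product_sigma_finite "\<lambda>_::nat. lborel :: complex measure" ..
  have "(\<integral>\<^sup>+x. ennreal (exp (- a * sqnorm D x + Re (\<Sum>i<D. w i * x i))) \<partial>lebesgue_CD D)
    = (\<integral>\<^sup>+x. (\<Prod>i<D. ennreal (exp (- a * (cmod (x i))\<^sup>2 + Re (w i * x i)))) \<partial>PiM {..<D} (\<lambda>_. lborel))"
    unfolding lebesgue_CD_def
    by (intro nn_integral_cong) (simp add: prod_ennreal exp_sum[symmetric] sqnorm_def sum.distrib
        sum_distrib_left sum_subtractf sum_negf)
  also have "\<dots> = (\<Prod>i<D. ennreal (pi / a * exp ((cmod (w i))\<^sup>2 / (4 * a))))"
    by (subst product_nn_integral_prod) (auto simp: nn_integral_complex_gauss[OF a, simplified])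
  also have "\<dots> = ennreal ((pi / a) ^ D * exp (sqnorm D w / (4 * a)))"
  proof -
    have "(\<Prod>i<D. pi / a * exp ((cmod (w i))\<^sup>2 / (4 * a))) = (pi / a) ^ D * exp (sqnorm D w / (4 * a))"
      unfolding prod.distrib by (simp add: exp_sum[symmetric] sqnorm_def sum_divide_distrib)
    then show ?thesis using a by (subst prod_ennreal) auto
  qed
  finally show ?thesis .
qed

text \<open>Apart from the origin, membership in such a set depends on the direction of a vector
  only. These are the sets on which the uniform distribution on the ball can be compared with a
  Gaussian.\<close>

locale cone =
  fixes D :: nat and C :: "(nat \<Rightarrow> complex) set"
  assumes sets_C: "C \<in> sets (PiM {..<D} (\<lambda>_. borel))"
    and scale_C: "\<And>x r. x \<in> C \<Longrightarrow> r > 0 \<Longrightarrow> (\<lambda>i\<in>{..<D}. complex_of_real r * x i) \<in> C"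
begin

text \<open>Since s bounds the squared norm, the dilation factor is sqrt s and its Jacobian is
  s^D.\<close>

lemma emeasure_cone_ball:
  assumes s: "s > 0"
  shows "emeasure (lebesgue_CD D) {x\<in>C. sqnorm D x \<le> s}
    = ennreal (s ^ D) * emeasure (lebesgue_CD D) {x\<in>C. sqnorm D x \<le> 1}"
proof -
  let ?r = "sqrt s" let ?T = "\<lambda>r x. \<lambda>i\<in>{..<D}. complex_of_real r * x i"
  note [measurable] = sets_C
  have C_sub: "C \<subseteq> extensional {..<D}" using sets.sets_into_space[OF sets_C] by (auto simp: space_PiM PiE_def)
  have m: "?T ?r \<in> lebesgue_CD D \<rightarrow>\<^sub>M PiM {..<D} (\<lambda>_. borel)" by measurable
  have sA: "{x\<in>C. sqnorm D x \<le> s} \<in> sets (PiM {..<D} (\<lambda>_. borel))"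
  proof -
    have "{x\<in>C. sqnorm D x \<le> s} = C \<inter> {x\<in>space (PiM {..<D} (\<lambda>_. borel)). sqnorm D x \<le> s}"
      using sets.sets_into_space[OF sets_C] by auto
    then show ?thesis by simp
  qed
  have pre: "?T ?r -` {x\<in>C. sqnorm D x \<le> s} \<inter> space (lebesgue_CD D) = {x\<in>C. sqnorm D x \<le> 1}"
  proof -
    have "x \<in> C" if "?T ?r x \<in> C" "x \<in> extensional {..<D}" for x
    proof -
      have "?T (1 / ?r) (?T ?r x) = x" 
        using s that(2) by (auto simp: fun_eq_iff extensional_def)
      then show ?thesis using scale_C[OF that(1), of "1 / ?r"] s by simp
    qed
    moreover have "sqnorm D (?T ?r x) \<le> s \<longleftrightarrow> sqnorm D x \<le> 1" for x
      using s by (simp only: sqnorm_scale) simp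
    moreover have "?T ?r x \<in> C" if "x \<in> C" for x
      using s by (intro scale_C that) simp
    ultimately show ?thesis
      using C_sub unfolding space_lebesgue_CD by blast
  qed
  have "emeasure (lebesgue_CD D) {x\<in>C. sqnorm D x \<le> s}
    = ennreal (?r ^ (2 * D)) * emeasure (lebesgue_CD D) (?T ?r -` {x\<in>C. sqnorm D x \<le> s} \<inter> space (lebesgue_CD D))"
    unfolding emeasure_distr[OF m sA, symmetric]
    using s by (subst lebesgue_CD_scale[of ?r D, symmetric]) (auto simp only: emeasure_scale_measure real_sqrt_gt_zero)
  then show ?thesis
    unfolding pre using s by (simp add: power_mult)
qed

text \<open>Write exp (- a) as the integral of exp (- s) over s \<ge> a and exchange the integrals.
  Level s then contributes the volume of C inside the ball of squared radius s, which is s^D times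
  the volume inside the unit ball.\<close>

lemma layer_cake:
  "(\<integral>\<^sup>+x. ennreal (exp (- sqnorm D x)) * indicator C x \<partial>lebesgue_CD D)
   = (\<integral>\<^sup>+s. ennreal (exp (- s) * s ^ D) * indicator {0<..} s \<partial>lborel) * emeasure (lebesgue_CD D) {x\<in>C. sqnorm D x \<le> 1}"
proof -
  interpret L: sigma_finite_measure "lebesgue_CD D" by (rule sigma_finite_lebesgue_CD)
  interpret P: pair_sigma_finite "lebesgue_CD D" "lborel :: real measure" ..
  note [measurable] = sets_C
  have C_sub: "C \<subseteq> space (lebesgue_CD D)" using sets.sets_into_space[OF sets_C] by (auto simp: space_PiM space_lebesgue_CD PiE_def)
  have tail: "ennreal (exp (- a)) = (\<integral>\<^sup>+s. ennreal (exp (- s)) * indicator {a..} s \<partial>lborel)" for a :: real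
  proof -
    have "(\<integral>\<^sup>+s. ennreal (exp (- s)) * indicator {a..} s \<partial>lborel) = ennreal (0 - (- exp (- a)))"
    proof (rule nn_integral_FTC_atLeast)
      show "((\<lambda>s::real. - exp (- s)) \<longlongrightarrow> 0) at_top"
        using tendsto_minus[OF filterlim_compose[OF exp_at_bot filterlim_uminus_at_bot_at_top]] by simp
    qed (auto intro!: derivative_eq_intros)
    then show ?thesis by simp
  qed
  have ind: "indicator {sqnorm D x..} s = (if sqnorm D x \<le> s then 1 else (0::ennreal))" for x s
    by (auto simp: indicator_def)
  have "(\<integral>\<^sup>+x. ennreal (exp (- sqnorm D x)) * indicator C x \<partial>lebesgue_CD D)
    = (\<integral>\<^sup>+x. (\<integral>\<^sup>+s. ennreal (exp (- s)) * (if sqnorm D x \<le> s then 1 else 0) * indicator C x \<partial>lborel) \<partial>lebesgue_CD D)"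
    by (subst tail) (auto simp: nn_integral_multc ind)
  also have "\<dots> = (\<integral>\<^sup>+s. (\<integral>\<^sup>+x. ennreal (exp (- s)) * (if sqnorm D x \<le> s then 1 else 0) * indicator C x \<partial>lebesgue_CD D) \<partial>lborel)"
    by (rule P.Fubini'[symmetric]) measurable
  also have "\<dots> = (\<integral>\<^sup>+s. ennreal (exp (- s)) * emeasure (lebesgue_CD D) {x\<in>C. sqnorm D x \<le> s} \<partial>lborel)"
  proof (rule nn_integral_cong)
    fix s :: real
    have sA: "{x\<in>C. sqnorm D x \<le> s} \<in> sets (lebesgue_CD D)"
    proof -
      have "{x\<in>C. sqnorm D x \<le> s} = C \<inter> {x\<in>space (lebesgue_CD D). sqnorm D x \<le> s}"
        using C_sub by auto
      then show ?thesis by simp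
    qed
    have "(\<integral>\<^sup>+x. ennreal (exp (- s)) * (if sqnorm D x \<le> s then 1 else 0) * indicator C x \<partial>lebesgue_CD D)
      = (\<integral>\<^sup>+x. ennreal (exp (- s)) * indicator {x\<in>C. sqnorm D x \<le> s} x \<partial>lebesgue_CD D)"
      by (intro nn_integral_cong) (auto simp: indicator_def)
    also have "\<dots> = ennreal (exp (- s)) * emeasure (lebesgue_CD D) {x\<in>C. sqnorm D x \<le> s}"
      using sA by (rule nn_integral_cmult_indicator)
    finally show "(\<integral>\<^sup>+x. ennreal (exp (- s)) * (if sqnorm D x \<le> s then 1 else 0) * indicator C x \<partial>lebesgue_CD D)
      = ennreal (exp (- s)) * emeasure (lebesgue_CD D) {x\<in>C. sqnorm D x \<le> s}" .
  qed
  also have "\<dots> = (\<integral>\<^sup>+s. ennreal (exp (- s) * s ^ D) * indicator {0<..} s * emeasure (lebesgue_CD D) {x\<in>C. sqnorm D x \<le> 1} \<partial>lborel)"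
  proof (rule nn_integral_cong_AE)
    \<comment> \<open>At s = 0 the layer may still contain the origin while the right-hand side is
      cut off, so the identity is claimed only away from this null point.\<close>
    have "AE s in lborel. s \<noteq> (0::real)" by (rule AE_lborel_singleton)
    then show "AE s in lborel. ennreal (exp (- s)) * emeasure (lebesgue_CD D) {x\<in>C. sqnorm D x \<le> s}
      = ennreal (exp (- s) * s ^ D) * indicator {0<..} s * emeasure (lebesgue_CD D) {x\<in>C. sqnorm D x \<le> 1}"
    proof eventually_elim
      case (elim s)
      show ?case
      proof (cases "s > 0")
        case True
        then show ?thesis unfolding emeasure_cone_ball[OF True] by (simp add: ennreal_mult' mult.assoc)
      next
        case False
        have "s < sqnorm D x" for x using False elim sqnorm_nonneg[of D x] by simp
        then have eq: "{x\<in>C. sqnorm D x \<le> s} = {}" by (auto simp: not_le)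
        show ?thesis unfolding eq using False by simp
      qed
    qed
  qed
  also have "\<dots> = (\<integral>\<^sup>+s. ennreal (exp (- s) * s ^ D) * indicator {0<..} s \<partial>lborel) * emeasure (lebesgue_CD D) {x\<in>C. sqnorm D x \<le> 1}"
    by (rule nn_integral_multc) measurable
  finally show ?thesis .
qed

end

abbreviation unit_ball :: "nat \<Rightarrow> (nat \<Rightarrow> complex) set" where
  "unit_ball D \<equiv> {x \<in> space (lebesgue_CD D). cvec_norm D x \<le> 1}"

lemma unit_ball_eq: "unit_ball D = {x \<in> space (lebesgue_CD D). sqnorm D x \<le> 1}"
  by (simp add: cvec_norm_def sqnorm_def)

lemma sets_unit_ball: "unit_ball D \<in> sets (lebesgue_CD D)"
  unfolding unit_ball_eq by measurable

lemma cone_space: "cone D (space (lebesgue_CD D))"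
proof
  show "space (lebesgue_CD D) \<in> sets (PiM {..<D} (\<lambda>_. borel))"
    using sets.top[of "lebesgue_CD D"] by (simp only: sets_lebesgue_CD)
qed (simp add: space_lebesgue_CD)

text \<open>Integrating \<open>exp (- \<parallel>x\<parallel>\<^sup>2)\<close> over a cone C in layers multiplies the volume of
  \<open>C \<inter> unit_ball\<close> by a factor that does not depend on C, so the uniform distribution on the ball and
  the Gaussian distribution give the same probability to every cone.\<close>

lemma gauss_total: "(\<integral>\<^sup>+x. ennreal (exp (- sqnorm D x)) * indicator (space (lebesgue_CD D)) x \<partial>lebesgue_CD D) = ennreal (pi ^ D)"
proof -
  have "(\<integral>\<^sup>+x. ennreal (exp (- sqnorm D x)) * indicator (space (lebesgue_CD D)) x \<partial>lebesgue_CD D)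
    = (\<integral>\<^sup>+x. ennreal (exp (- 1 * sqnorm D x + Re (\<Sum>i<D. (\<lambda>_. 0) i * x i))) \<partial>lebesgue_CD D)"
    by (intro nn_integral_cong) auto
  then show ?thesis by (simp only: nn_integral_lebesgue_CD_gauss) (simp add: sqnorm_def)
qed

text \<open>The whole space is a cone, so the volume of the ball times the radial factor is pi^D. A
  product that is neither 0 nor infinite forces the same on the ball, without computing its
  volume.\<close>

lemma emeasure_unit_ball: "emeasure (lebesgue_CD D) (unit_ball D) \<noteq> 0" "emeasure (lebesgue_CD D) (unit_ball D) \<noteq> \<infinity>"
proof -
  let ?G = "\<integral>\<^sup>+s. ennreal (exp (- s) * s ^ D) * indicator {0<..} s \<partial>lborel"
  have *: "?G * emeasure (lebesgue_CD D) (unit_ball D) = ennreal (pi ^ D)"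
    unfolding gauss_total[symmetric] unit_ball_eq by (rule cone.layer_cake[OF cone_space, symmetric])
  then show "emeasure (lebesgue_CD D) (unit_ball D) \<noteq> 0" "emeasure (lebesgue_CD D) (unit_ball D) \<noteq> \<infinity>"
    by (auto simp: ennreal_mult_top split: if_splits)
qed

lemma (in cone) uniform_ball_cone:
  "emeasure (uniform_measure (lebesgue_CD D) (unit_ball D)) C
   = (\<integral>\<^sup>+x. ennreal (exp (- sqnorm D x)) * indicator C x \<partial>lebesgue_CD D) / ennreal (pi ^ D)"
proof -
  let ?G = "\<integral>\<^sup>+s. ennreal (exp (- s) * s ^ D) * indicator {0<..} s \<partial>lborel"
  let ?b = "emeasure (lebesgue_CD D) (unit_ball D)"
  let ?c = "emeasure (lebesgue_CD D) {x\<in>C. sqnorm D x \<le> 1}"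
  have C_sub: "C \<subseteq> space (lebesgue_CD D)" using sets.sets_into_space[OF sets_C] by (auto simp: space_PiM space_lebesgue_CD PiE_def)
  have *: "?G * ?b = ennreal (pi ^ D)"
    unfolding gauss_total[symmetric] unit_ball_eq by (rule cone.layer_cake[OF cone_space, symmetric])
  \<comment> \<open>The radial factor \<open>?G\<close> is D!, but to cancel it from the quotient it
    suffices that it is positive and finite, which follows from its product with the positive ball
    volume being pi^D.\<close>
  have G0: "?G \<noteq> 0" using * by auto
  have Gtop: "?G \<noteq> \<top>" using * emeasure_unit_ball(1)[of D] by (auto simp: ennreal_top_mult)
  have "emeasure (uniform_measure (lebesgue_CD D) (unit_ball D)) C = emeasure (lebesgue_CD D) (unit_ball D \<inter> C) / ?b"
    using sets_C sets_unit_ball by (intro emeasure_uniform_measure) (auto simp: sets_lebesgue_CD)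
  also have "unit_ball D \<inter> C = {x\<in>C. sqnorm D x \<le> 1}" using C_sub unfolding unit_ball_eq by auto
  also have "?c / ?b = (?G * ?c) / (?G * ?b)"
    using divide_mult_eq[OF G0, of ?c ?b] Gtop by (simp add: mult.commute infinity_ennreal_def)
  finally show ?thesis unfolding layer_cake * .
qed

lemma prob_space_uniform_ball: "prob_space (uniform_measure (lebesgue_CD D) (unit_ball D))"
  using emeasure_unit_ball by (intro prob_space_uniform_measure) auto

section \<open>The radial projection and the uniform distribution on the sphere\<close>

lemma measurable_radial_projection [measurable]:
  "(\<lambda>x. \<lambda>i\<in>{..<D}. complex_of_real (sqrt (real D) / cvec_norm D x) * x i)
    \<in> PiM {..<D} (\<lambda>_. borel) \<rightarrow>\<^sub>M PiM {..<D} (\<lambda>_. borel)"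
proof -
  have [measurable]: "cvec_norm D \<in> borel_measurable (PiM {..<D} (\<lambda>_. borel))"
    unfolding cvec_norm_def[abs_def] sqnorm_def[symmetric] by measurable
  show ?thesis
    by (intro measurable_restrict borel_measurable_times measurable_component_complex) auto
qed

lemma sets_unif_sphere [measurable_cong, simp]: "sets (unif_sphere D) = sets (PiM {..<D} (\<lambda>_. borel))"
  by (simp add: unif_sphere_def)

lemma measurable_radial_projection_ball:
  "(\<lambda>x. \<lambda>i\<in>{..<D}. complex_of_real (sqrt (real D) / cvec_norm D x) * x i)
    \<in> uniform_measure (lebesgue_CD D) (unit_ball D) \<rightarrow>\<^sub>M PiM {..<D} (\<lambda>_. borel)"
proof -
  have "sets (uniform_measure (lebesgue_CD D) (unit_ball D)) = sets (PiM {..<D} (\<lambda>_. borel))"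
    by (simp add: sets_lebesgue_CD)
  from measurable_cong_sets[OF this refl] measurable_radial_projection[of D] show ?thesis by simp
qed

lemma prob_space_unif_sphere: "prob_space (unif_sphere D)"
  unfolding unif_sphere_def
  by (intro prob_space.prob_space_distr prob_space_uniform_ball measurable_radial_projection_ball)

text \<open>The projection fails to normalise only at the origin, where division by 0 makes it
  vanish. For D \<ge> 1 the origin is a Lebesgue null set, hence also null for the uniform
  distribution on the ball.\<close>

lemma AE_unif_sphere_sqnorm:
  assumes D: "D \<ge> 1"
  shows "AE a in unif_sphere D. sqnorm D a = real D"
proof -
  interpret product_sigma_finite "\<lambda>_::nat. lborel :: complex measure" ..
  let ?f = "\<lambda>x. \<lambda>i\<in>{..<D}. complex_of_real (sqrt (real D) / cvec_norm D x) * x i"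
  let ?Z = "PiE {..<D} (\<lambda>_. {0::complex})"
  have Z0: "emeasure (lebesgue_CD D) ?Z = 0"
    unfolding lebesgue_CD_def using D by (subst emeasure_PiM) auto
  have "?Z \<in> sets (lebesgue_CD D)"
    unfolding sets_lebesgue_CD by (intro sets_PiM_I_finite) auto
  then have "AE x in lebesgue_CD D. x \<notin> ?Z"
    by (intro AE_not_in null_setsI Z0)
  then have "AE x in lebesgue_CD D. sqnorm D (?f x) = real D"
  proof (rule AE_mp[OF _ AE_I2], intro impI)
    fix x assume x: "x \<in> space (lebesgue_CD D)" "x \<notin> ?Z"
    have "x \<in> ?Z" if "sqnorm D x = 0"
    proof (rule PiE_I)
      show "x i \<in> {0}" if "i \<in> {..<D}" for i
        using \<open>sqnorm D x = 0\<close> that by (simp add: sqnorm_def sum_nonneg_eq_0_iff)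
      show "x i = undefined" if "i \<notin> {..<D}" for i
        using x(1) that by (simp add: space_lebesgue_CD extensional_def)
    qed
    with x(2) have "sqnorm D x \<noteq> 0" by blast
    then have "cvec_norm D x \<noteq> 0" using cvec_norm_square[of D x] by auto
    then show "sqnorm D (?f x) = real D"
      unfolding sqnorm_scale by (simp add: power_divide cvec_norm_square[symmetric])
  qed
  then have "AE x in uniform_measure (lebesgue_CD D) (unit_ball D). sqnorm D (?f x) = real D"
    by (intro AE_uniform_measureI sets_unit_ball) auto
  then show ?thesis
    unfolding unif_sphere_def
    by (subst AE_distr_iff[OF measurable_radial_projection_ball]) measurable
qed

text \<open>On the cone either x is short or the correlation itself is at least sqrt (R D) / 2, and
  each alternative is dominated by an exponential with a computable Gaussian integral. The tilt s
  minimises s^2 D / 4 - s sqrt (R D) / 4: the first term is what the integral yields when b has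
  squared norm D, the second is the gain left after the quarter turn.\<close>

lemma gauss_cone_tail_pointwise:
  fixes R :: real
  assumes D: "D \<ge> 1" and R: "R \<ge> 0" and ip: "R * sqnorm D x < (cmod (cip D x b))\<^sup>2"
  defines "s \<equiv> sqrt (R / real D) / 2"
  shows "exp (- sqnorm D x) \<le> exp (real D / 4) * exp (- 2 * sqnorm D x) +
    (\<Sum>c\<in>{1, -1, \<i>, -\<i>}. exp (- R / 8) * exp (- 1 * sqnorm D x + Re (\<Sum>i<D. (of_real s * c * cnj (b i)) * x i)))"
    (is "_ \<le> ?A + sum ?f ?C")
proof (cases "sqnorm D x \<le> real D / 4")
  case True
  have "exp (- sqnorm D x) \<le> ?A" using True by (simp add: exp_add[symmetric])
  moreover have "0 \<le> sum ?f ?C" by (intro sum_nonneg) auto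
  ultimately show ?thesis by linarith
next
  case False
  let ?z = "cnj (cip D x b)"
  have s: "s \<ge> 0" using R by (simp add: s_def)
  have "R * (real D / 4) \<le> R * sqnorm D x" using False R by (intro mult_left_mono) auto
  then have "sqrt (R * (real D / 4)) \<le> sqrt ((cmod ?z)\<^sup>2)" using ip by (intro real_sqrt_le_mono) simp
  then have z: "sqrt R * sqrt (real D) / 2 \<le> cmod ?z"
    by (simp add: real_sqrt_mult real_sqrt_divide)
  obtain c where c: "c \<in> ?C" and cz: "cmod ?z / 2 \<le> Re (c * ?z)" using exists_quarter_turn by blast
  have "(\<Sum>i<D. (of_real s * c * cnj (b i)) * x i) = of_real s * (c * ?z)"
    by (simp add: cip_def sum_distrib_left ac_simps)
  then have Re_eq: "Re (\<Sum>i<D. (of_real s * c * cnj (b i)) * x i) = s * Re (c * ?z)" by simp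
  have "R / 8 = s * (sqrt R * sqrt (real D) / 2 / 2)"
    using D R by (simp add: s_def real_sqrt_divide)
  also have "\<dots> \<le> s * Re (c * ?z)" using z cz by (intro mult_left_mono s) linarith
  finally have "exp (- sqnorm D x) \<le> ?f c"
    unfolding Re_eq by (simp add: exp_add[symmetric])
  also have "?f c \<le> sum ?f ?C" using c by (intro member_le_sum) auto
  finally show ?thesis by (simp add: add_increasing)
qed

text \<open>Both sides of the correlation inequality scale alike, so its preimage in the ball is a
  cone and may be measured by the Gaussian. The two terms of the bound stem from atypically short
  Gaussian vectors and from large correlations.\<close>

lemma unif_sphere_cip_tail:
  fixes R :: real
  assumes D: "D \<ge> 1" and R: "R \<ge> 0" and b: "sqnorm D b \<le> real D"
  shows "emeasure (unif_sphere D) {a\<in>space (unif_sphere D). real D * R < (cmod (cip D a b))\<^sup>2}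
    \<le> ennreal (exp (- real D / 4) + 4 * exp (- R / 16))"
proof -
  define s where "s = sqrt (R / real D) / 2"
  let ?K = "{1, -1, \<i>, -\<i>} :: complex set"
  let ?f = "\<lambda>x. \<lambda>i\<in>{..<D}. complex_of_real (sqrt (real D) / cvec_norm D x) * x i"
  define C where "C = {x \<in> space (lebesgue_CD D). R * sqnorm D x < (cmod (cip D x b))\<^sup>2}"
  have sC: "C \<in> sets (lebesgue_CD D)" unfolding C_def by measurable
  interpret cone D C
  proof
    show "C \<in> sets (PiM {..<D} (\<lambda>_. borel))" using sC by (simp add: sets_lebesgue_CD)
    fix x r assume x: "x \<in> C" and r: "(r::real) > 0"
    have "(R * sqnorm D x) * r\<^sup>2 < (cmod (cip D x b))\<^sup>2 * r\<^sup>2"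
      using x r by (intro mult_strict_right_mono) (auto simp: C_def)
    then show "(\<lambda>i\<in>{..<D}. complex_of_real r * x i) \<in> C"
      by (simp add: C_def space_lebesgue_CD sqnorm_scale cip_scale norm_mult power_mult_distrib mult_ac)
  qed
  have pre: "?f -` {a\<in>space (unif_sphere D). real D * R < (cmod (cip D a b))\<^sup>2} \<inter> space (uniform_measure (lebesgue_CD D) (unit_ball D)) = C"
  proof -
    have "real D * R < (cmod (cip D (?f x) b))\<^sup>2 \<longleftrightarrow> R * sqnorm D x < (cmod (cip D x b))\<^sup>2" for x
    \<comment> \<open>At the origin the projection is 0 and both inequalities fail, because R \<ge>
      0.\<close>
    proof (cases "cvec_norm D x = 0")
      case True
      then have "sqnorm D x = 0" using cvec_norm_square[of D x] by simp
      moreover from this have "cip D x b = 0"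
        by (simp add: sqnorm_def cip_def sum_nonneg_eq_0_iff)
      moreover have "\<not> real D * R < 0" using R by (simp add: not_less)
      ultimately show ?thesis unfolding cip_scale by simp
    next
      case False
      then have "cvec_norm D x ^ 2 > 0" by simp
      then show ?thesis
        using D unfolding cip_scale
        by (simp add: norm_mult power_mult_distrib norm_divide power_divide cvec_norm_square[symmetric] pos_less_divide_eq mult_ac)
    qed
    then show ?thesis
      by (auto simp: C_def unif_sphere_def space_lebesgue_CD space_PiM PiE_def)
  qed
  have m: "{a\<in>space (unif_sphere D). real D * R < (cmod (cip D a b))\<^sup>2} \<in> sets (PiM {..<D} (\<lambda>_. borel))"
    unfolding sets_unif_sphere[symmetric] by measurable
  have "emeasure (unif_sphere D) {a\<in>space (unif_sphere D). real D * R < (cmod (cip D a b))\<^sup>2}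
    = emeasure (uniform_measure (lebesgue_CD D) (unit_ball D)) C"
    unfolding pre[symmetric] by (subst unif_sphere_def) (rule emeasure_distr[OF measurable_radial_projection_ball m])
  also have "\<dots> = (\<integral>\<^sup>+x. ennreal (exp (- sqnorm D x)) * indicator C x \<partial>lebesgue_CD D) / ennreal (pi ^ D)"
    by (rule uniform_ball_cone)
  also have "(\<integral>\<^sup>+x. ennreal (exp (- sqnorm D x)) * indicator C x \<partial>lebesgue_CD D) \<le>
    (\<integral>\<^sup>+x. ennreal (exp (real D / 4)) * ennreal (exp (- 2 * sqnorm D x + Re (\<Sum>i<D. 0 * x i))) +
      (\<Sum>c\<in>?K. ennreal (exp (- R / 8)) * ennreal (exp (- 1 * sqnorm D x + Re (\<Sum>i<D. (of_real s * c * cnj (b i)) * x i)))) \<partial>lebesgue_CD D)"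
  proof (rule nn_integral_mono)
    fix x
    show "ennreal (exp (- sqnorm D x)) * indicator C x \<le> ennreal (exp (real D / 4)) * ennreal (exp (- 2 * sqnorm D x + Re (\<Sum>i<D. 0 * x i))) +
      (\<Sum>c\<in>?K. ennreal (exp (- R / 8)) * ennreal (exp (- 1 * sqnorm D x + Re (\<Sum>i<D. (of_real s * c * cnj (b i)) * x i))))"
    proof (cases "x \<in> C")
      case True
      then have ip: "R * sqnorm D x < (cmod (cip D x b))\<^sup>2" by (simp add: C_def)
      have "ennreal (exp (- sqnorm D x)) \<le> ennreal (exp (real D / 4) * exp (- 2 * sqnorm D x) +
        (\<Sum>c\<in>?K. exp (- R / 8) * exp (- 1 * sqnorm D x + Re (\<Sum>i<D. (of_real s * c * cnj (b i)) * x i))))"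
        using gauss_cone_tail_pointwise[OF D R ip] unfolding s_def by (intro ennreal_leI)
      also have "\<dots> = ennreal (exp (real D / 4)) * ennreal (exp (- 2 * sqnorm D x + Re (\<Sum>i<D. 0 * x i))) +
        (\<Sum>c\<in>?K. ennreal (exp (- R / 8)) * ennreal (exp (- 1 * sqnorm D x + Re (\<Sum>i<D. (of_real s * c * cnj (b i)) * x i))))"
        by (subst ennreal_plus) (auto intro!: sum_nonneg simp del: sum.insert simp: ennreal_mult' sum_ennreal[symmetric])
      finally show ?thesis using True by simp
    qed simp
  qed
  also have "\<dots> = ennreal (exp (real D / 4)) * ennreal ((pi / 2) ^ D * exp (sqnorm D (\<lambda>_. 0) / (4 * 2))) +
     (\<Sum>c\<in>?K. ennreal (exp (- R / 8)) * ennreal ((pi / 1) ^ D * exp (sqnorm D (\<lambda>i. of_real s * c * cnj (b i)) / (4 * 1))))"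
  proof -
    have [measurable]: "(\<lambda>x. Re (\<Sum>i<D. w i * x i)) \<in> borel_measurable (lebesgue_CD D)" for w
    proof -
      have "(\<lambda>x. Re (\<Sum>i<D. w i * x i)) \<in> borel_measurable (PiM {..<D} (\<lambda>_. borel))"
        by (intro measurable_compose[OF _ borel_measurable_Re] borel_measurable_sum borel_measurable_times measurable_component_complex) auto
      then show ?thesis by (simp cong: measurable_cong_sets add: sets_lebesgue_CD)
    qed
    have [measurable]: "sqnorm D \<in> borel_measurable (lebesgue_CD D)" by measurable
    \<comment> \<open>One family covers both kinds of terms: a = 2 with w = 0 for short vectors, a =
      1 with a tilt w for correlations.\<close>
    define g where "g = (\<lambda>a w x. ennreal (exp (- a * sqnorm D x + Re (\<Sum>i<D. w i * x i))))"
    have [measurable]: "g a w \<in> borel_measurable (lebesgue_CD D)" for a w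
      unfolding g_def by measurable
    have g_int: "integral\<^sup>N (lebesgue_CD D) (g a w) = ennreal ((pi / a) ^ D * exp (sqnorm D w / (4 * a)))" if "a > 0" for a w
      unfolding g_def by (rule nn_integral_lebesgue_CD_gauss[OF that])
    have "(\<integral>\<^sup>+x. ennreal (exp (real D / 4)) * g 2 (\<lambda>_. 0) x +
      (\<Sum>c\<in>?K. ennreal (exp (- R / 8)) * g 1 (\<lambda>i. of_real s * c * cnj (b i)) x) \<partial>lebesgue_CD D)
      = (\<integral>\<^sup>+x. ennreal (exp (real D / 4)) * g 2 (\<lambda>_. 0) x \<partial>lebesgue_CD D) +
      (\<integral>\<^sup>+x. (\<Sum>c\<in>?K. ennreal (exp (- R / 8)) * g 1 (\<lambda>i. of_real s * c * cnj (b i)) x) \<partial>lebesgue_CD D)"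
      by (rule nn_integral_add) measurable
    also have "(\<integral>\<^sup>+x. (\<Sum>c\<in>?K. ennreal (exp (- R / 8)) * g 1 (\<lambda>i. of_real s * c * cnj (b i)) x) \<partial>lebesgue_CD D)
      = (\<Sum>c\<in>?K. \<integral>\<^sup>+x. ennreal (exp (- R / 8)) * g 1 (\<lambda>i. of_real s * c * cnj (b i)) x \<partial>lebesgue_CD D)"
      by (rule nn_integral_sum) measurable
    moreover have "(\<integral>\<^sup>+x. ennreal k * g a w x \<partial>lebesgue_CD D) = ennreal k * integral\<^sup>N (lebesgue_CD D) (g a w)" for k a w
      by (rule nn_integral_cmult) measurable
    ultimately show ?thesis
      by (simp only: g_int zero_less_numeral zero_less_one) (simp only: g_def)
  qed
  also have "\<dots> \<le> ennreal (exp (real D / 4)) * ennreal ((pi / 2) ^ D) + (\<Sum>c\<in>?K. ennreal (exp (- R / 8)) * ennreal (pi ^ D * exp (R / 16)))"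
  proof (intro add_mono mult_left_mono sum_mono ennreal_leI)
    show "(pi / 2) ^ D * exp (sqnorm D (\<lambda>_. 0) / (4 * 2)) \<le> (pi / 2) ^ D" by (simp add: sqnorm_def)
    fix c assume "c \<in> ?K"
    then have c: "cmod c = 1" by auto
    \<comment> \<open>With s^2 D = R / 4 the tilt costs at most exp (R / 16), against the gain exp
      (- R / 8).\<close>
    have "sqnorm D (\<lambda>i. of_real s * c * cnj (b i)) = s\<^sup>2 * sqnorm D b"
      by (simp add: sqnorm_def norm_mult c power_mult_distrib sum_distrib_left)
    also have "\<dots> \<le> s\<^sup>2 * real D" by (intro mult_left_mono b) auto
    also have "\<dots> = R / 4" using D R by (simp add: s_def power_divide)
    finally show "(pi / 1) ^ D * exp (sqnorm D (\<lambda>i. of_real s * c * cnj (b i)) / (4 * 1)) \<le> pi ^ D * exp (R / 16)" by simp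
  qed auto
  also have "\<dots> = ennreal (pi ^ D * ((exp (1 / 4) / 2) ^ D + 4 * exp (- R / 16)))"
  proof -
    have "card ?K = 4" by (simp add: complex_eq_iff)
    then have "ennreal (exp (real D / 4)) * ennreal ((pi / 2) ^ D) + (\<Sum>c\<in>?K. ennreal (exp (- R / 8)) * ennreal (pi ^ D * exp (R / 16)))
      = ennreal (exp (real D / 4) * (pi / 2) ^ D) + ennreal (4 * (exp (- R / 8) * (pi ^ D * exp (R / 16))))"
      by (simp add: ennreal_mult'[symmetric] ennreal_numeral[symmetric] del: ennreal_numeral)
    also have "\<dots> = ennreal (exp (real D / 4) * (pi / 2) ^ D + 4 * (exp (- R / 8) * (pi ^ D * exp (R / 16))))"
      by (rule ennreal_plus[symmetric]) auto
    also have "exp (real D / 4) * (pi / 2) ^ D + 4 * (exp (- R / 8) * (pi ^ D * exp (R / 16)))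
      = pi ^ D * ((exp (1 / 4) / 2) ^ D + 4 * exp (- R / 16))"
    proof -
      have "exp (real D / 4) = exp (1 / 4) ^ D" by (simp add: exp_of_nat_mult[symmetric])
      moreover have "exp (- R / 16) = exp (- R / 8) * exp (R / 16)" by (simp add: exp_add[symmetric])
      ultimately show ?thesis by (simp only: power_divide) (simp add: algebra_simps)
    qed
    finally show ?thesis .
  qed
  also have "\<dots> / ennreal (pi ^ D) = ennreal ((exp (1 / 4) / 2) ^ D + 4 * exp (- R / 16))"
    by (subst divide_ennreal) auto
  also have "\<dots> \<le> ennreal (exp (- real D / 4) + 4 * exp (- R / 16))"
  proof -
    \<comment> \<open>By e^(1/2) \<le> 2, the base e^(1/4) / 2 of the short-vector term is at most
      e^(-1/4).\<close>
    have "exp (1 / 4 :: real) \<le> 2 * exp (- 1 / 4)"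
      using exp_half_le_2 by (simp add: exp_minus field_simps exp_add[symmetric])
    then have "(exp (1 / 4 :: real) / 2) ^ D \<le> exp (- 1 / 4) ^ D" by (intro power_mono) auto
    also have "exp (- 1 / 4 :: real) ^ D = exp (- real D / 4)" by (simp add: exp_of_nat_mult[symmetric])
    finally show ?thesis by (intro ennreal_leI) simp
  qed
  finally show ?thesis by (simp add: divide_right_mono_ennreal)
qed

section \<open>Recovery on the good event\<close>

text \<open>The weights \<open>\<omega>\<close> are upper bounds for the standard deviations \<open>sqrt v\<close>. Below, the noise rows
  get the weight \<open>sqrt (\<sigma>\<^sup>2 + g)\<close>, which is positive even if \<open>\<sigma> = 0\<close> and does not change Q by more
  than a constant factor.\<close>

lemma hermitian_form_deviation:
  fixes w :: "'p \<Rightarrow> complex" and v \<omega> :: "'p \<Rightarrow> real"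
  assumes P: "finite P"
    and T: "\<And>p q. p \<in> P \<Longrightarrow> q \<in> P \<Longrightarrow> cmod (T p q - of_real (if p = q then v p else 0)) \<le> \<delta> * (\<omega> p * \<omega> q)"
  shows "\<bar>Re (\<Sum>p\<in>P. \<Sum>q\<in>P. w p * cnj (w q) * T p q) - (\<Sum>p\<in>P. (cmod (w p))\<^sup>2 * v p)\<bar>
    \<le> \<delta> * (\<Sum>p\<in>P. cmod (w p) * \<omega> p)\<^sup>2"
proof -
  let ?d = "\<lambda>p q. complex_of_real (if p = q then v p else 0)"
  have "(\<Sum>p\<in>P. \<Sum>q\<in>P. w p * cnj (w q) * ?d p q) = (\<Sum>p\<in>P. \<Sum>q\<in>P. if p = q then w p * cnj (w p) * of_real (v p) else 0)"
    by (intro sum.cong) auto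
  also have "\<dots> = (\<Sum>p\<in>P. w p * cnj (w p) * of_real (v p))"
    using P by simp
  also have "\<dots> = of_real (\<Sum>p\<in>P. (cmod (w p))\<^sup>2 * v p)"
    by (simp add: complex_norm_square[symmetric] del: of_real_power)
  finally have d: "(\<Sum>p\<in>P. \<Sum>q\<in>P. w p * cnj (w q) * ?d p q) = of_real (\<Sum>p\<in>P. (cmod (w p))\<^sup>2 * v p)" .
  have "\<bar>Re (\<Sum>p\<in>P. \<Sum>q\<in>P. w p * cnj (w q) * T p q) - (\<Sum>p\<in>P. (cmod (w p))\<^sup>2 * v p)\<bar>
    = \<bar>Re ((\<Sum>p\<in>P. \<Sum>q\<in>P. w p * cnj (w q) * T p q) - (\<Sum>p\<in>P. \<Sum>q\<in>P. w p * cnj (w q) * ?d p q))\<bar>"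
    unfolding d by simp
  also have "\<dots> \<le> cmod ((\<Sum>p\<in>P. \<Sum>q\<in>P. w p * cnj (w q) * T p q) - (\<Sum>p\<in>P. \<Sum>q\<in>P. w p * cnj (w q) * ?d p q))"
    by (rule abs_Re_le_cmod)
  also have "\<dots> = cmod (\<Sum>p\<in>P. \<Sum>q\<in>P. w p * cnj (w q) * (T p q - ?d p q))"
    by (simp only: sum_subtractf[symmetric] right_diff_distrib[symmetric])
  also have "\<dots> \<le> (\<Sum>p\<in>P. \<Sum>q\<in>P. cmod (w p) * cmod (w q) * (\<delta> * (\<omega> p * \<omega> q)))"
    using T by (intro sum_norm_le) (simp only: norm_mult complex_mod_cnj mult_left_mono mult_nonneg_nonneg norm_ge_zero)
  \<comment> \<open>The entrywise bound is a product of a factor in p and a factor in q, so the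
    double sum is a square; this is where the weighted l1 norm arises.\<close>
  also have "\<dots> = \<delta> * (\<Sum>p\<in>P. cmod (w p) * \<omega> p)\<^sup>2"
    by (simp add: power2_eq_square sum_product sum_distrib_left ac_simps)
  finally show ?thesis .
qed

text \<open>The rows of H and of Z are stacked over a sum type, so that signal, noise and cross
  terms become entries of a single Gram matrix.\<close>

definition gram_vec :: "(nat \<times> nat \<Rightarrow> complex) \<Rightarrow> (nat \<times> nat \<Rightarrow> complex) \<Rightarrow> nat + nat \<Rightarrow> nat \<Rightarrow> complex" where
  "gram_vec H Z p m = (case p of Inl l \<Rightarrow> H (l, m) | Inr i \<Rightarrow> Z (i, m))"

definition proj_coeff :: "nat \<Rightarrow> (nat \<Rightarrow> real) \<Rightarrow> (nat \<Rightarrow> nat \<Rightarrow> complex) \<Rightarrow> nat \<Rightarrow> nat + nat \<Rightarrow> complex" where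
  "proj_coeff D \<gamma> A k p = (case p of Inl l \<Rightarrow> of_real (sqrt (\<gamma> l)) * cip D (A k) (A l) | Inr i \<Rightarrow> cnj (A k i))"

text \<open>The statistic is the average over m of the squared modulus of the projection of column m
  of Y onto column k of A; expanding each projection in the stacked rows gives the form. Rows of H
  off the support have coefficient 0, so the sum over them collapses to S.\<close>

lemma calY_eq_form:
  fixes D N M :: nat
  assumes S: "S \<subseteq> {..<N}" and \<gamma>: "\<And>l. l < N \<Longrightarrow> l \<notin> S \<Longrightarrow> \<gamma> l = 0"
  defines "P \<equiv> S <+> {..<D}"
  shows "calY D N M \<gamma> A H Z k = (\<Sum>p\<in>P. \<Sum>q\<in>P. proj_coeff D \<gamma> A k p * cnj (proj_coeff D \<gamma> A k q) *
    ((\<Sum>m<M. gram_vec H Z p m * cnj (gram_vec H Z q m)) / of_nat M))"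
proof -
  let ?w = "proj_coeff D \<gamma> A k" and ?G = "gram_vec H Z" and ?Y = "Ymat N \<gamma> A H Z"
  have fS: "finite S" using S finite_subset by blast
  have proj: "(\<Sum>i<D. cnj (A k i) * ?Y i m) = (\<Sum>p\<in>P. ?w p * ?G p m)" for m
  proof -
    have "(\<Sum>i<D. cnj (A k i) * ?Y i m)
      = (\<Sum>i<D. \<Sum>l<N. cnj (A k i) * (A l i * of_real (sqrt (\<gamma> l)) * H (l, m))) + (\<Sum>i<D. cnj (A k i) * Z (i, m))"
      by (simp add: Ymat_def distrib_left sum.distrib sum_distrib_left)
    also have "(\<Sum>i<D. \<Sum>l<N. cnj (A k i) * (A l i * of_real (sqrt (\<gamma> l)) * H (l, m)))
      = (\<Sum>l<N. \<Sum>i<D. cnj (A k i) * (A l i * of_real (sqrt (\<gamma> l)) * H (l, m)))"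
      by (rule sum.swap)
    also have "\<dots> = (\<Sum>l<N. of_real (sqrt (\<gamma> l)) * cip D (A k) (A l) * H (l, m))"
      by (simp add: cip_def sum_distrib_left sum_distrib_right ac_simps)
    also have "\<dots> = (\<Sum>l\<in>S. of_real (sqrt (\<gamma> l)) * cip D (A k) (A l) * H (l, m))"
      using S \<gamma> by (intro sum.mono_neutral_right) auto
    finally show ?thesis
      using fS unfolding P_def by (simp add: sum.Plus proj_coeff_def gram_vec_def)
  qed
  have "calY D N M \<gamma> A H Z k = (\<Sum>i<D. \<Sum>j<D. \<Sum>m<M. (cnj (A k i) * ?Y i m) * cnj (cnj (A k j) * ?Y j m)) / of_nat M"
    by (simp add: calY_def Sigma_hat_def sum_distrib_left sum_divide_distrib ac_simps)
  also have "(\<Sum>i<D. \<Sum>j<D. \<Sum>m<M. (cnj (A k i) * ?Y i m) * cnj (cnj (A k j) * ?Y j m))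
    = (\<Sum>i<D. \<Sum>m<M. \<Sum>j<D. (cnj (A k i) * ?Y i m) * cnj (cnj (A k j) * ?Y j m))"
    by (intro sum.cong refl sum.swap)
  also have "\<dots> = (\<Sum>m<M. \<Sum>i<D. \<Sum>j<D. (cnj (A k i) * ?Y i m) * cnj (cnj (A k j) * ?Y j m))"
    by (rule sum.swap)
  also have "\<dots> = (\<Sum>m<M. (\<Sum>p\<in>P. ?w p * ?G p m) * cnj (\<Sum>p\<in>P. ?w p * ?G p m))"
    by (simp only: proj[symmetric] cnj_sum sum_product)
  also have "\<dots> = (\<Sum>m<M. \<Sum>p\<in>P. \<Sum>q\<in>P. (?w p * cnj (?w q)) * (?G p m * cnj (?G q m)))"
    by (simp add: sum_product ac_simps)
  also have "\<dots> = (\<Sum>p\<in>P. \<Sum>m<M. \<Sum>q\<in>P. (?w p * cnj (?w q)) * (?G p m * cnj (?G q m)))"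
    by (rule sum.swap)
  also have "\<dots> = (\<Sum>p\<in>P. \<Sum>q\<in>P. \<Sum>m<M. (?w p * cnj (?w q)) * (?G p m * cnj (?G q m)))"
    by (intro sum.cong refl sum.swap)
  finally show ?thesis
    by (simp add: sum_distrib_left sum_divide_distrib)
qed

lemma cip_self: "cip D a a = of_real (sqnorm D a)"
  by (simp add: cip_def sqnorm_def complex_norm_square mult.commute del: of_real_power)

lemma sum_cmod_le:
  assumes "sqnorm D a = real D"
  shows "(\<Sum>i<D. cmod (a i)) \<le> real D"
proof -
  have "(\<Sum>i<D. cmod (a i))\<^sup>2 \<le> real D * (\<Sum>i<D. (cmod (a i))\<^sup>2)"
    using sum_squared_le_sum_of_squares[of "\<lambda>i. cmod (a i)" "{..<D}"] by (simp add: mult.commute)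
  also have "\<dots> = (real D)\<^sup>2" using assms by (simp add: sqnorm_def power2_eq_square)
  finally show ?thesis by (rule power2_le_imp_le) simp
qed

text \<open>As all columns have the same norm, the noise adds the same \<sigma>^2 D to every mean,
  and only the signal separates the indices. The means differ by at least 3 g D^2 / 4, and the
  precision 1 / (96 Q) is chosen to keep each deviation below g D^2 / 8.\<close>

lemma top_set_of_good_event:
  fixes \<gamma> :: "nat \<Rightarrow> real" and S :: "nat set" and g g' \<sigma> R :: real and D N M :: nat
  defines "P \<equiv> S <+> {..<D}" and "Q \<equiv> (g' * real (card S) + \<sigma>\<^sup>2) / g" and "K \<equiv> real (card S)"
  defines "v \<equiv> case_sum (\<lambda>_. 1) (\<lambda>_. \<sigma>\<^sup>2)" and "\<omega> \<equiv> case_sum (\<lambda>_. 1) (\<lambda>_. sqrt (\<sigma>\<^sup>2 + g))"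
  assumes S: "S \<subseteq> {..<N}" "S \<noteq> {}" and \<gamma>0: "\<And>l. l < N \<Longrightarrow> l \<notin> S \<Longrightarrow> \<gamma> l = 0"
    and g: "g > 0" and \<gamma>: "\<And>l. l \<in> S \<Longrightarrow> g \<le> \<gamma> l \<and> \<gamma> l \<le> g'"
    and D: "D \<ge> 1" and M: "M \<ge> 1" and R: "R \<ge> 0" and KR: "K * g' * R \<le> g * real D / 4"
    and sq: "\<And>k. k < N \<Longrightarrow> sqnorm D (A k) = real D"
    and cross: "\<And>k l. k < N \<Longrightarrow> l < N \<Longrightarrow> k \<noteq> l \<Longrightarrow> (cmod (cip D (A k) (A l)))\<^sup>2 \<le> real D * R"
    and gram: "\<And>p q. p \<in> P \<Longrightarrow> q \<in> P \<Longrightarrow> cmod ((\<Sum>m<M. gram_vec H Z p m * cnj (gram_vec H Z q m))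
        - of_nat M * of_real (if p = q then v p else 0)) \<le> real M * (1 / (96 * Q)) * (\<omega> p * \<omega> q)"
  shows "top_set_is N (calY D N M \<gamma> A H Z) S"
proof -
  let ?w = "proj_coeff D \<gamma> A"
  define m where "m = (\<lambda>k. \<Sum>p\<in>P. (cmod (?w k p))\<^sup>2 * v p)"
  define W where "W = (\<lambda>k. \<Sum>p\<in>P. cmod (?w k p) * \<omega> p)"
  have fS: "finite S" using S finite_subset by blast
  have fP: "finite P" using fS by (simp add: P_def)
  have K1: "K \<ge> 1" using fS S(2) by (simp add: K_def Suc_le_eq card_gt_0_iff)
  have gg: "g \<le> g'" using \<gamma> S(2) by fastforce
  have g': "g' > 0" using gg g by simp
  have g'K: "g' \<le> g' * K" using K1 g' by simp
  then have gK: "g \<le> g' * K" using gg by linarith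
  have Qg: "Q * g = g' * K + \<sigma>\<^sup>2" using g by (simp add: Q_def K_def)
  have Q: "Q > 0" using g g' K1 unfolding Q_def K_def by (intro divide_pos_pos add_pos_nonneg) auto
  have gram': "cmod ((\<Sum>m<M. gram_vec H Z p m * cnj (gram_vec H Z q m)) / of_nat M
      - of_real (if p = q then v p else 0)) \<le> 1 / (96 * Q) * (\<omega> p * \<omega> q)" if pq: "p \<in> P" "q \<in> P" for p q
  proof -
    let ?T = "\<Sum>m<M. gram_vec H Z p m * cnj (gram_vec H Z q m)" and ?d = "complex_of_real (if p = q then v p else 0)"
    have "?T / of_nat M - ?d = (?T - of_nat M * ?d) / of_nat M"
      using M by (simp add: diff_divide_distrib)
    then have "cmod (?T / of_nat M - ?d) = cmod (?T - of_nat M * ?d) / real M" by (simp only: norm_divide norm_of_nat)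
    also have "\<dots> \<le> (real M * (1 / (96 * Q)) * (\<omega> p * \<omega> q)) / real M"
      by (intro divide_right_mono gram pq) simp
    also have "\<dots> = 1 / (96 * Q) * (\<omega> p * \<omega> q)" using M by simp
    finally show ?thesis .
  qed
  have dev: "\<bar>Re (calY D N M \<gamma> A H Z k) - m k\<bar> \<le> 1 / (96 * Q) * (W k)\<^sup>2" for k
  proof -
    have form: "calY D N M \<gamma> A H Z k = (\<Sum>p\<in>P. \<Sum>q\<in>P. ?w k p * cnj (?w k q) *
        ((\<Sum>m<M. gram_vec H Z p m * cnj (gram_vec H Z q m)) / of_nat M))"
      unfolding P_def by (rule calY_eq_form[OF S(1)]) (rule \<gamma>0)
    show ?thesis
      unfolding m_def W_def form by (rule hermitian_form_deviation[OF fP]) (rule gram')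
  qed
  have m_eq: "m k = (\<Sum>l\<in>S. \<gamma> l * (cmod (cip D (A k) (A l)))\<^sup>2) + \<sigma>\<^sup>2 * sqnorm D (A k)" for k
  proof -
    have "(cmod (of_real (sqrt (\<gamma> l)) * cip D (A k) (A l)))\<^sup>2 = \<gamma> l * (cmod (cip D (A k) (A l)))\<^sup>2" if "l \<in> S" for l
      using \<gamma>[OF that] g by (simp add: norm_mult power_mult_distrib)
    then show ?thesis
      using fS unfolding m_def P_def
      by (simp add: sum.Plus proj_coeff_def v_def sqnorm_def sum_distrib_left mult.commute)
  qed
  have W_bound: "1 / (96 * Q) * (W k)\<^sup>2 \<le> g * (real D)\<^sup>2 / 8" if k: "k < N" for k
  proof -
    \<comment> \<open>\<open>?a\<close> is the contribution of column k itself (present only for k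
      in S, but charged to every k), \<open>?b\<close> that of the other support columns,
      \<open>?c\<close> that of the noise rows.\<close>
    let ?a = "sqrt g' * real D" and ?b = "K * (sqrt g' * sqrt (real D * R))" and ?c = "sqrt (\<sigma>\<^sup>2 + g) * real D"
    have W_eq: "W k = (\<Sum>l\<in>S. sqrt (\<gamma> l) * cmod (cip D (A k) (A l))) + sqrt (\<sigma>\<^sup>2 + g) * (\<Sum>i<D. cmod (A k i))"
    proof -
      have "cmod (of_real (sqrt (\<gamma> l)) * cip D (A k) (A l)) = sqrt (\<gamma> l) * cmod (cip D (A k) (A l))" if "l \<in> S" for l
        using \<gamma>[OF that] g by (simp add: norm_mult)
      then show ?thesis
        using fS unfolding W_def P_def
        by (simp add: sum.Plus proj_coeff_def \<omega>_def sum_distrib_right mult.commute[of "sqrt (\<sigma>\<^sup>2 + g)"])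
    qed
    have "(\<Sum>l\<in>S. sqrt (\<gamma> l) * cmod (cip D (A k) (A l))) \<le> (\<Sum>l\<in>S. sqrt g' * sqrt (real D * R) + (if l = k then ?a else 0))"
    proof (rule sum_mono)
      fix l assume l: "l \<in> S"
      have "sqrt (\<gamma> l) * cmod (cip D (A k) (A l)) \<le> sqrt g' * (if l = k then real D else sqrt (real D * R))"
      proof (rule mult_mono)
        show "sqrt (\<gamma> l) \<le> sqrt g'" using \<gamma>[OF l] by simp
        show "cmod (cip D (A k) (A l)) \<le> (if l = k then real D else sqrt (real D * R))"
          using cross[of k l] l S(1) k sq[OF k] by (auto simp: cip_self real_le_rsqrt)
      qed (use g' in auto)
      also have "\<dots> \<le> sqrt g' * sqrt (real D * R) + (if l = k then ?a else 0)"
        using g' R by (auto simp: real_sqrt_mult)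
      finally show "sqrt (\<gamma> l) * cmod (cip D (A k) (A l)) \<le> sqrt g' * sqrt (real D * R) + (if l = k then ?a else 0)" .
    qed
    also have "\<dots> \<le> ?b + ?a"
      using fS g' by (simp add: sum.distrib K_def)
    finally have "W k \<le> ?a + ?b + ?c"
      using mult_left_mono[OF sum_cmod_le[OF sq[OF k]], of "sqrt (\<sigma>\<^sup>2 + g)"] g unfolding W_eq by simp
    moreover have "0 \<le> W k" unfolding W_def \<omega>_def using g by (intro sum_nonneg) (auto split: sum.split)
    ultimately have "(W k)\<^sup>2 \<le> (?a + ?b + ?c)\<^sup>2" by (rule power_mono)
    also have "\<dots> \<le> 3 * (?a\<^sup>2 + ?b\<^sup>2 + ?c\<^sup>2)"
    proof -
      have "3 * (x\<^sup>2 + y\<^sup>2 + z\<^sup>2) - (x + y + z)\<^sup>2 = (x - y)\<^sup>2 + (y - z)\<^sup>2 + (x - z)\<^sup>2" for x y z :: real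
        by (simp add: power2_eq_square algebra_simps)
      from this[of ?a ?b ?c] show ?thesis by (smt (verit) zero_le_power2)
    qed
    also have "\<dots> \<le> 12 * (real D)\<^sup>2 * (Q * g)"
    proof -
      have a: "?a\<^sup>2 \<le> (real D)\<^sup>2 * (g' * K)"
        using g' mult_left_mono[OF g'K, of "(real D)\<^sup>2"] by (simp add: power_mult_distrib mult.commute)
      have "?b\<^sup>2 = K\<^sup>2 * (g' * (real D * R))"
        using g' R by (simp add: power_mult_distrib)
      also have "\<dots> = K * real D * (K * g' * R)" by (simp add: power2_eq_square)
      \<comment> \<open>The hypothesis \<open>KR\<close> turns the K^2 R D of the cross terms into K
        D^2, within the budget D^2 g' K.\<close>
      also have "\<dots> \<le> K * real D * (g * real D / 4)" by (intro mult_left_mono KR) (use K1 in auto)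
      also have "\<dots> \<le> K * real D * (g' * real D / 4)" using K1 gg by (intro mult_left_mono divide_right_mono mult_right_mono) auto
      finally have b: "?b\<^sup>2 \<le> (real D)\<^sup>2 * (g' * K) / 4" by (simp add: power2_eq_square mult_ac)
      \<comment> \<open>The g added to the noise weight is absorbed by g' K, as K \<ge> 1.\<close>
      have c: "?c\<^sup>2 \<le> (real D)\<^sup>2 * (g' * K + \<sigma>\<^sup>2)"
        using g gK by (simp add: power_mult_distrib mult.commute mult_left_mono)
      \<comment> \<open>The sum only reaches 27/4 X + 3 Y; the rounded factor 12 accounts for 96 =
        12 * 8 in the precision.\<close>
      have lin: "3 * (a + b + c) \<le> r" if "a \<le> X" "b \<le> X / 4" "c \<le> X + Y" "0 \<le> X" "0 \<le> Y" "r = 12 * X + 12 * Y"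
        for a b c r X Y :: real using that by simp
      show ?thesis
      proof (rule lin[OF a b])
        show "?c\<^sup>2 \<le> (real D)\<^sup>2 * (g' * K) + (real D)\<^sup>2 * \<sigma>\<^sup>2" using c by (simp only: distrib_left)
        show "0 \<le> (real D)\<^sup>2 * \<sigma>\<^sup>2" "0 \<le> (real D)\<^sup>2 * (g' * K)" using g' K1 by simp_all
        show "12 * (real D)\<^sup>2 * (Q * g) = 12 * ((real D)\<^sup>2 * (g' * K)) + 12 * ((real D)\<^sup>2 * \<sigma>\<^sup>2)"
          unfolding Qg distrib_left by (simp only: mult.assoc)
      qed
    qed
    finally have "1 / (96 * Q) * (W k)\<^sup>2 \<le> 1 / (96 * Q) * (12 * (real D)\<^sup>2 * (Q * g))"
      using Q by (intro mult_left_mono) auto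
    also have "\<dots> = g * (real D)\<^sup>2 / 8" using Q by simp
    finally show ?thesis .
  qed
  have "Re (calY D N M \<gamma> A H Z l) < Re (calY D N M \<gamma> A H Z k)" if k: "k \<in> S" and l: "l \<in> {..<N} - S" for k l
  proof -
    have kN: "k < N" and lN: "l < N" using k l S(1) by auto
    have \<gamma>_nonneg: "0 \<le> \<gamma> j" if "j \<in> S" for j using \<gamma>[OF that] g by simp
    have "g * (real D)\<^sup>2 \<le> \<gamma> k * (cmod (cip D (A k) (A k)))\<^sup>2"
      using \<gamma>[OF k] by (simp add: cip_self sq[OF kN] mult_right_mono)
    also have "\<dots> \<le> (\<Sum>l\<in>S. \<gamma> l * (cmod (cip D (A k) (A l)))\<^sup>2)"
      using fS k by (intro member_le_sum[where f = "\<lambda>l. \<gamma> l * (cmod (cip D (A k) (A l)))\<^sup>2"]) (auto simp: \<gamma>_nonneg)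
    finally have mk: "g * (real D)\<^sup>2 + \<sigma>\<^sup>2 * real D \<le> m k" by (simp add: m_eq sq[OF kN])
    have "(\<Sum>j\<in>S. \<gamma> j * (cmod (cip D (A l) (A j)))\<^sup>2) \<le> (\<Sum>j\<in>S. g' * (real D * R))"
    proof (rule sum_mono)
      fix j assume j: "j \<in> S"
      then show "\<gamma> j * (cmod (cip D (A l) (A j)))\<^sup>2 \<le> g' * (real D * R)"
        using \<gamma>[OF j] g' lN l S(1) by (intro mult_mono cross) auto
    qed
    also have "\<dots> = real D * (K * g' * R)" by (simp add: K_def)
    also have "\<dots> \<le> real D * (g * real D / 4)" by (intro mult_left_mono KR) auto
    finally have ml: "m l \<le> g * (real D)\<^sup>2 / 4 + \<sigma>\<^sup>2 * real D"
      by (simp add: m_eq sq[OF lN] power2_eq_square mult_ac)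
    have pos: "0 < g * (real D)\<^sup>2" using g D by simp
    \<comment> \<open>In the worst case a is at least 7 G / 8 + n, while b is at most 3 G / 8 +
      n.\<close>
    have lin: "b < a" if "\<bar>a - m1\<bar> \<le> e1" "\<bar>b - m2\<bar> \<le> e2" "e1 \<le> G / 8" "e2 \<le> G / 8" "G + n \<le> m1" "m2 \<le> G / 4 + n" "0 < G"
      for a b m1 m2 e1 e2 G n :: real using that by linarith
    show ?thesis
      by (rule lin[OF dev[of k] dev[of l] W_bound[OF kN] W_bound[OF lN] mk ml pos])
  qed
  then show ?thesis using S(1) by (simp add: top_set_is_def)
qed

section \<open>The Gaussian part of the model\<close>

definition noise_space :: "nat \<Rightarrow> nat \<Rightarrow> nat \<Rightarrow> real \<Rightarrow> ((nat \<times> nat \<Rightarrow> complex) \<times> (nat \<times> nat \<Rightarrow> complex)) measure" where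
  "noise_space D N M \<sigma> = PiM ({..<N} \<times> {..<M}) (\<lambda>_. cgauss 1) \<Otimes>\<^sub>M PiM ({..<D} \<times> {..<M}) (\<lambda>_. cgauss (\<sigma>\<^sup>2))"

definition variance_of :: "real \<Rightarrow> nat + nat \<Rightarrow> real" where
  "variance_of \<sigma> = case_sum (\<lambda>_. 1) (\<lambda>_. \<sigma>\<^sup>2)"

lemma prob_space_noise: "prob_space (noise_space D N M \<sigma>)"
proof -
  interpret H: prob_space "PiM ({..<N} \<times> {..<M}) (\<lambda>_. cgauss 1)"
    by (intro prob_space_PiM prob_space_cgauss) auto
  interpret Z: prob_space "PiM ({..<D} \<times> {..<M}) (\<lambda>_. cgauss (\<sigma>\<^sup>2))"
    by (intro prob_space_PiM prob_space_cgauss) auto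
  interpret pair_prob_space "PiM ({..<N} \<times> {..<M}) (\<lambda>_. cgauss 1)" "PiM ({..<D} \<times> {..<M}) (\<lambda>_. cgauss (\<sigma>\<^sup>2))" ..
  show ?thesis unfolding noise_space_def by unfold_locales
qed

lemma measurable_gram_vec:
  assumes "p \<in> {..<N} <+> {..<D}" "m < M"
  shows "(\<lambda>(H, Z). gram_vec H Z p m) \<in> borel_measurable (noise_space D N M \<sigma>)"
proof (cases p)
  case (Inl l)
  have "(\<lambda>H. H (l, m)) \<in> PiM ({..<N} \<times> {..<M}) (\<lambda>_. cgauss 1) \<rightarrow>\<^sub>M cgauss 1"
    using assms Inl by (intro measurable_component_singleton) auto
  then have "(\<lambda>H. H (l, m)) \<in> borel_measurable (PiM ({..<N} \<times> {..<M}) (\<lambda>_. cgauss 1))"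
    by (simp cong: measurable_cong_sets)
  from measurable_compose[OF measurable_fst this] show ?thesis
    by (simp add: Inl gram_vec_def noise_space_def case_prod_beta')
next
  case (Inr i)
  have "(\<lambda>Z. Z (i, m)) \<in> PiM ({..<D} \<times> {..<M}) (\<lambda>_. cgauss (\<sigma>\<^sup>2)) \<rightarrow>\<^sub>M cgauss (\<sigma>\<^sup>2)"
    using assms Inr by (intro measurable_component_singleton) auto
  then have "(\<lambda>Z. Z (i, m)) \<in> borel_measurable (PiM ({..<D} \<times> {..<M}) (\<lambda>_. cgauss (\<sigma>\<^sup>2)))"
    by (simp cong: measurable_cong_sets)
  from measurable_compose[OF measurable_snd this] show ?thesis
    by (simp add: Inr gram_vec_def noise_space_def case_prod_beta')
qed

lemma ball_Plus_Times:
  "(\<forall>(p, m)\<in>(A <+> B) \<times> C. Q p m) \<longleftrightarrow> (\<forall>a\<in>A. \<forall>m\<in>C. Q (Inl a) m) \<and> (\<forall>b\<in>B. \<forall>m\<in>C. Q (Inr b) m)"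
  by auto

text \<open>Rectangles determine a product measure, so this one computation supplies both the
  marginal laws and the independence: the two product spaces act as a single product over the
  stacked index set.\<close>

lemma noise_rectangle:
  fixes D N M :: nat
  defines "I \<equiv> ({..<N} <+> {..<D}) \<times> {..<M}"
  assumes E: "\<And>i. i \<in> I \<Longrightarrow> E i \<in> sets borel"
  shows "emeasure (noise_space D N M \<sigma>) {(H, Z) \<in> space (noise_space D N M \<sigma>). \<forall>(p, m)\<in>I. gram_vec H Z p m \<in> E (p, m)}
    = (\<Prod>(p, m)\<in>I. emeasure (cgauss (variance_of \<sigma> p)) (E (p, m)))"
proof -
  let ?IH = "{..<N} \<times> {..<M}" and ?IZ = "{..<D} \<times> {..<M}"
  let ?EH = "\<lambda>(l, m). E (Inl l, m)" and ?EZ = "\<lambda>(i, m). E (Inr i, m)"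
  interpret H: prob_space "PiM ?IH (\<lambda>_. cgauss 1)"
    by (intro prob_space_PiM prob_space_cgauss) auto
  interpret Z: prob_space "PiM ?IZ (\<lambda>_. cgauss (\<sigma>\<^sup>2))"
    by (intro prob_space_PiM prob_space_cgauss) auto
  have EH: "?EH i \<in> sets borel" if "i \<in> ?IH" for i
    using that by (auto simp: I_def split: prod.splits intro!: E)
  have EZ: "?EZ i \<in> sets borel" if "i \<in> ?IZ" for i
    using that by (auto simp: I_def split: prod.splits intro!: E)
  interpret P1: product_prob_space "\<lambda>_. cgauss 1" ?IH
    using prob_space_cgauss[of 1] by (simp add: product_prob_spaceI)
  interpret P2: product_prob_space "\<lambda>_. cgauss (\<sigma>\<^sup>2)" ?IZ
    using prob_space_cgauss[of "\<sigma>\<^sup>2"] by (simp add: product_prob_spaceI)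
  have "{(H, Z) \<in> space (noise_space D N M \<sigma>). \<forall>(p, m)\<in>I. gram_vec H Z p m \<in> E (p, m)} = PiE ?IH ?EH \<times> PiE ?IZ ?EZ"
    unfolding I_def ball_Plus_Times
    by (auto simp: noise_space_def space_pair_measure space_PiM gram_vec_def PiE_def Pi_def)
  also have "emeasure (noise_space D N M \<sigma>) \<dots> = emeasure (PiM ?IH (\<lambda>_. cgauss 1)) (PiE ?IH ?EH) * emeasure (PiM ?IZ (\<lambda>_. cgauss (\<sigma>\<^sup>2))) (PiE ?IZ ?EZ)"
    unfolding noise_space_def using EH EZ
    by (intro Z.emeasure_pair_measure_Times sets_PiM_I_finite) auto
  also have "\<dots> = (\<Prod>i\<in>?IH. emeasure (cgauss 1) (?EH i)) * (\<Prod>i\<in>?IZ. emeasure (cgauss (\<sigma>\<^sup>2)) (?EZ i))"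
    using EH EZ by (subst P1.emeasure_PiM, simp, simp, subst P2.emeasure_PiM) auto
  also have "\<dots> = (\<Prod>(p, m)\<in>I. emeasure (cgauss (variance_of \<sigma> p)) (E (p, m)))"
  proof -
    have "(\<Prod>i\<in>?IH. emeasure (cgauss 1) (?EH i)) = (\<Prod>(l, m)\<in>?IH. emeasure (cgauss 1) (E (Inl l, m)))"
      by (intro prod.cong) auto
    moreover have "(\<Prod>i\<in>?IZ. emeasure (cgauss (\<sigma>\<^sup>2)) (?EZ i)) = (\<Prod>(i, m)\<in>?IZ. emeasure (cgauss (\<sigma>\<^sup>2)) (E (Inr i, m)))"
      by (intro prod.cong) auto
    ultimately show ?thesis
      unfolding I_def prod.cartesian_product[symmetric] by (simp add: prod.Plus variance_of_def)
  qed
  finally show ?thesis .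
qed

text \<open>Take a rectangle all of whose sides but one are \<open>UNIV\<close>, hence of
  probability 1.\<close>

lemma noise_law:
  assumes p: "p \<in> {..<N} <+> {..<D}" and m: "m < M"
  shows "distr (noise_space D N M \<sigma>) borel (\<lambda>(H, Z). gram_vec H Z p m) = cgauss (variance_of \<sigma> p)"
proof (rule measure_eqI)
  fix X assume "X \<in> sets (distr (noise_space D N M \<sigma>) borel (\<lambda>(H, Z). gram_vec H Z p m))"
  then have X: "X \<in> sets borel" by simp
  let ?I = "({..<N} <+> {..<D}) \<times> {..<M}"
  let ?E = "\<lambda>i. if i = (p, m) then X else UNIV"
  have one: "emeasure (cgauss (variance_of \<sigma> q)) UNIV = 1" for q
    using prob_space.emeasure_space_1[OF prob_space_cgauss, of "variance_of \<sigma> q"]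
    by (auto simp: variance_of_def split: sum.split)
  have pm: "(p, m) \<in> ?I" using p m by auto
  have "emeasure (distr (noise_space D N M \<sigma>) borel (\<lambda>(H, Z). gram_vec H Z p m)) X
    = emeasure (noise_space D N M \<sigma>) {(H, Z) \<in> space (noise_space D N M \<sigma>). \<forall>(q, n)\<in>?I. gram_vec H Z q n \<in> ?E (q, n)}"
    using X pm by (subst emeasure_distr[OF measurable_gram_vec[OF p m]]) (auto intro!: arg_cong2[where f = emeasure])
  also have "\<dots> = (\<Prod>(q, n)\<in>?I. emeasure (cgauss (variance_of \<sigma> q)) (?E (q, n)))"
    using X by (intro noise_rectangle) auto
  also have "\<dots> = (\<Prod>i\<in>?I. if i = (p, m) then emeasure (cgauss (variance_of \<sigma> p)) X else 1)"
  proof (rule prod.cong)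
    fix i assume "i \<in> ?I"
    show "(case i of (q, n) \<Rightarrow> emeasure (cgauss (variance_of \<sigma> q)) (?E (q, n)))
      = (if i = (p, m) then emeasure (cgauss (variance_of \<sigma> p)) X else 1)"
      by (cases i) (auto simp: one)
  qed simp
  also have "\<dots> = emeasure (cgauss (variance_of \<sigma> p)) X" using pm by (subst prod.delta) auto
  finally show "emeasure (distr (noise_space D N M \<sigma>) borel (\<lambda>(H, Z). gram_vec H Z p m)) X = emeasure (cgauss (variance_of \<sigma> p)) X" .
qed simp

lemma noise_indep:
  assumes D: "D \<ge> 1" and M: "M \<ge> 1"
  shows "prob_space.indep_vars (noise_space D N M \<sigma>) (\<lambda>_. borel) (\<lambda>(p, m). \<lambda>(H, Z). gram_vec H Z p m) (({..<N} <+> {..<D}) \<times> {..<M})"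
proof -
  interpret prob_space "noise_space D N M \<sigma>" by (rule prob_space_noise)
  let ?I = "({..<N} <+> {..<D}) \<times> {..<M}"
  let ?X = "\<lambda>(p, m). \<lambda>(H, Z). gram_vec H Z p m"
  let ?L = "\<lambda>(p :: nat + nat, m :: nat). cgauss (variance_of \<sigma> p)"
  \<comment> \<open>D and M positive keep the index set nonempty, as the characterisation of
    independence by the joint law requires.\<close>
  have I: "finite ?I" "?I \<noteq> {}" using D M by (auto simp: lessThan_empty_iff)
  have rv: "random_variable borel (?X i)" if "i \<in> ?I" for i
    using that by (cases i) (auto intro!: measurable_gram_vec)
  have "prob_space (?L i)" for i
    by (cases i) (auto intro!: prob_space_cgauss simp: variance_of_def split: sum.split)
  then interpret L: product_sigma_finite ?L
    by (intro product_sigma_finite.intro prob_space_imp_sigma_finite)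
  have "distr (noise_space D N M \<sigma>) (PiM ?I (\<lambda>_. borel)) (\<lambda>x. \<lambda>i\<in>?I. ?X i x) = PiM ?I ?L"
  proof (rule L.PiM_eqI[OF I(1)])
    fix E assume "\<And>i. i \<in> ?I \<Longrightarrow> E i \<in> sets (?L i)"
    then have E: "E i \<in> sets borel" if "i \<in> ?I" for i
      using that by (cases i) fastforce
    have "emeasure (distr (noise_space D N M \<sigma>) (PiM ?I (\<lambda>_. borel)) (\<lambda>x. \<lambda>i\<in>?I. ?X i x)) (PiE ?I E)
      = emeasure (noise_space D N M \<sigma>) ((\<lambda>x. \<lambda>i\<in>?I. ?X i x) -` PiE ?I E \<inter> space (noise_space D N M \<sigma>))"
      using E I rv by (intro emeasure_distr measurable_restrict sets_PiM_I_finite) auto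
    also have "(\<lambda>x. \<lambda>i\<in>?I. ?X i x) -` PiE ?I E \<inter> space (noise_space D N M \<sigma>)
      = {(H, Z) \<in> space (noise_space D N M \<sigma>). \<forall>(p, m)\<in>?I. gram_vec H Z p m \<in> E (p, m)}"
    proof (rule set_eqI)
      fix x
      show "x \<in> (\<lambda>x. \<lambda>i\<in>?I. ?X i x) -` PiE ?I E \<inter> space (noise_space D N M \<sigma>) \<longleftrightarrow>
        x \<in> {(H, Z) \<in> space (noise_space D N M \<sigma>). \<forall>(p, m)\<in>?I. gram_vec H Z p m \<in> E (p, m)}"
        unfolding vimage_eq Int_iff restrict_PiE_iff by (cases x) auto
    qed
    also have "emeasure (noise_space D N M \<sigma>) \<dots> = (\<Prod>(p, m)\<in>?I. emeasure (cgauss (variance_of \<sigma> p)) (E (p, m)))"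
      by (rule noise_rectangle) (rule E)
    also have "\<dots> = (\<Prod>i\<in>?I. emeasure (?L i) (E i))" by (intro prod.cong) auto
    finally show "emeasure (distr (noise_space D N M \<sigma>) (PiM ?I (\<lambda>_. borel)) (\<lambda>x. \<lambda>i\<in>?I. ?X i x)) (PiE ?I E)
      = (\<Prod>i\<in>?I. emeasure (?L i) (E i))" .
  qed (auto intro!: sets_PiM_cong)
  also have "PiM ?I ?L = PiM ?I (\<lambda>i. distr (noise_space D N M \<sigma>) borel (?X i))"
  proof (rule PiM_cong[OF refl])
    show "?L i = distr (noise_space D N M \<sigma>) borel (?X i)" if "i \<in> ?I" for i
      using that noise_law[of "fst i" N D "snd i" M \<sigma>] by (cases i) auto
  qed
  finally show ?thesis
    using I rv by (subst indep_vars_iff_distr_eq_PiM') auto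
qed

text \<open>Only rows of H in the support enter. With card S \<le> D there are at most 2 D stacked
  rows, so the union bound costs 16 D^2 and N does not appear.\<close>

lemma noise_event:
  fixes S :: "nat set" and D N M :: nat and \<sigma> g \<delta> :: real
  assumes D: "D \<ge> 1" and M: "M \<ge> 1" and S: "S \<subseteq> {..<N}" "card S \<le> D" and g: "g > 0" and \<delta>: "0 < \<delta>" "\<delta> \<le> 1"
  defines "\<omega> \<equiv> case_sum (\<lambda>_. 1) (\<lambda>_. sqrt (\<sigma>\<^sup>2 + g))" and "P \<equiv> S <+> {..<D}"
  defines "B \<equiv> {(H, Z) \<in> space (noise_space D N M \<sigma>). \<exists>p\<in>P. \<exists>q\<in>P. real M * \<delta> * (\<omega> p * \<omega> q) <
      cmod ((\<Sum>m<M. gram_vec H Z p m * cnj (gram_vec H Z q m)) - of_nat M * of_real (if p = q then variance_of \<sigma> p else 0))}"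
  shows "B \<in> sets (noise_space D N M \<sigma>)"
    and "measure (noise_space D N M \<sigma>) B \<le> 16 * (real D)\<^sup>2 * exp (- real M * \<delta>\<^sup>2 / 2048)"
proof -
  interpret prob_space "noise_space D N M \<sigma>" by (rule prob_space_noise)
  have fS: "finite S" using S finite_subset by blast
  have fP: "finite P" using fS by (simp add: P_def)
  have P_sub: "P \<subseteq> {..<N} <+> {..<D}" using S by (auto simp: P_def)
  let ?G = "\<lambda>p m (H, Z). gram_vec H Z p m"
  have B_eq: "B = {x \<in> space (noise_space D N M \<sigma>). \<exists>p\<in>P. \<exists>q\<in>P. real M * \<delta> * (\<omega> p * \<omega> q) <
      cmod ((\<Sum>m<M. ?G p m x * cnj (?G q m x)) - of_nat M * of_real (if p = q then variance_of \<sigma> p else 0))}"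
    unfolding B_def by (auto simp: case_prod_beta')
  have [measurable]: "?G p m \<in> borel_measurable (noise_space D N M \<sigma>)" if "p \<in> P" "m < M" for p m
    using measurable_gram_vec[of p N D m M \<sigma>] that P_sub by auto
  show "B \<in> sets (noise_space D N M \<sigma>)"
  proof -
    have "(\<lambda>x. cmod ((\<Sum>m<M. ?G p m x * cnj (?G q m x)) - of_nat M * of_real (if p = q then variance_of \<sigma> p else 0)))
      \<in> borel_measurable (noise_space D N M \<sigma>)" if "p \<in> P" "q \<in> P" for p q
      using that by measurable
    then show ?thesis unfolding B_eq using fP
      by (intro sets.sets_Collect_finite_Ex borel_measurable_less) auto
  qed
  have "measure (noise_space D N M \<sigma>) B \<le> 4 * (real (card P))\<^sup>2 * exp (- real M * \<delta>\<^sup>2 / 2048)"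
    unfolding B_eq
  proof (rule gram_deviation_prob[OF fP])
    show "indep_vars (\<lambda>_. borel) (\<lambda>(p, m). ?G p m) (P \<times> {..<M})"
      by (rule indep_vars_subset[OF noise_indep[OF D M]]) (use P_sub in blast)
    show "distr (noise_space D N M \<sigma>) borel (?G p m) = cgauss (variance_of \<sigma> p)" if "p \<in> P" "m < M" for p m
      using that P_sub by (intro noise_law) auto
    show "0 \<le> variance_of \<sigma> p \<and> variance_of \<sigma> p \<le> (\<omega> p)\<^sup>2" if "p \<in> P" for p
      using g by (auto simp: variance_of_def \<omega>_def split: sum.split)
    show "\<omega> p > 0" if "p \<in> P" for p
      using g by (auto simp: \<omega>_def add_nonneg_pos split: sum.split)
  qed (use \<delta> in auto)
  also have "\<dots> \<le> 4 * (2 * real D)\<^sup>2 * exp (- real M * \<delta>\<^sup>2 / 2048)"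
  proof -
    have "card P = card S + D" using fS by (simp add: P_def card_Plus)
    then have "real (card P) \<le> 2 * real D" using S(2) by simp
    then show ?thesis by (intro mult_right_mono mult_left_mono power_mono) auto
  qed
  finally show "measure (noise_space D N M \<sigma>) B \<le> 16 * (real D)\<^sup>2 * exp (- real M * \<delta>\<^sup>2 / 2048)"
    by (simp add: power_mult_distrib)
qed

section \<open>Probability of recovery\<close>

definition sphere_space :: "nat \<Rightarrow> nat \<Rightarrow> (nat \<Rightarrow> nat \<Rightarrow> complex) measure" where
  "sphere_space D N = PiM {..<N} (\<lambda>_. unif_sphere D)"

lemma prob_space_sphere_space: "prob_space (sphere_space D N)"
  unfolding sphere_space_def by (intro prob_space_PiM prob_space_unif_sphere)

lemma measurable_sphere_column:
  "k < N \<Longrightarrow> (\<lambda>A. A k) \<in> sphere_space D N \<rightarrow>\<^sub>M unif_sphere D"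
  unfolding sphere_space_def by (intro measurable_component_singleton) auto

lemma measurable_sphere_entry:
  assumes "k < N" "i < D"
  shows "(\<lambda>A. A k i) \<in> borel_measurable (sphere_space D N)"
proof -
  have "(\<lambda>a. a i) \<in> borel_measurable (unif_sphere D)"
    using measurable_component_complex[OF assms(2)] by (simp cong: measurable_cong_sets)
  from measurable_compose[OF measurable_sphere_column[OF assms(1)] this] show ?thesis .
qed

lemma measurable_sphere_cip:
  assumes "k < N" "l < N"
  shows "(\<lambda>A. cip D (A k) (A l)) \<in> borel_measurable (sphere_space D N)"
proof -
  have "(\<lambda>A. \<Sum>i<D. cnj (A k i) * A l i) \<in> borel_measurable (sphere_space D N)"
    using assms
    by (intro borel_measurable_sum borel_measurable_times measurable_compose[OF _ measurable_cnj] measurable_sphere_entry) auto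
  then show ?thesis by (simp add: cip_def)
qed

text \<open>Freeze all columns except k: column l is then a fixed vector, almost surely of squared
  norm D, and the tail bound for one uniform vector applies to the inner integral.\<close>

lemma sphere_pair_tail:
  fixes R :: real
  assumes D: "D \<ge> 1" and R: "R \<ge> 0" and kl: "k < N" "l < N" "k \<noteq> l"
  shows "emeasure (sphere_space D N) {A \<in> space (sphere_space D N). real D * R < (cmod (cip D (A k) (A l)))\<^sup>2}
    \<le> ennreal (exp (- real D / 4) + 4 * exp (- R / 16))" (is "emeasure _ ?E \<le> ennreal ?\<beta>")
proof -
  let ?I = "{..<N} - {k}"
  interpret product_sigma_finite "\<lambda>_::nat. unif_sphere D"
    by (intro product_sigma_finite.intro prob_space_imp_sigma_finite prob_space_unif_sphere)
  interpret I: prob_space "PiM ?I (\<lambda>_. unif_sphere D)"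
    by (intro prob_space_PiM prob_space_unif_sphere)
  have ins: "insert k ?I = {..<N}" using kl by auto
  have E[measurable]: "?E \<in> sets (sphere_space D N)"
    using measurable_sphere_cip[OF kl(1,2), of D] by measurable
  have "emeasure (sphere_space D N) ?E = (\<integral>\<^sup>+A. indicator ?E A \<partial>PiM (insert k ?I) (\<lambda>_. unif_sphere D))"
    unfolding ins sphere_space_def[symmetric] by simp
  also have "\<dots> = (\<integral>\<^sup>+x. (\<integral>\<^sup>+y. indicator ?E (x(k := y)) \<partial>unif_sphere D) \<partial>PiM ?I (\<lambda>_. unif_sphere D))"
  proof (rule product_nn_integral_insert)
    show "indicator ?E \<in> borel_measurable (PiM (insert k ?I) (\<lambda>_. unif_sphere D))"
      unfolding ins sphere_space_def[symmetric] using E by (rule borel_measurable_indicator)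
  qed auto
  also have "\<dots> \<le> (\<integral>\<^sup>+x. ennreal ?\<beta> \<partial>PiM ?I (\<lambda>_. unif_sphere D))"
  proof (rule nn_integral_mono_AE)
    have "AE x in PiM ?I (\<lambda>_. unif_sphere D). sqnorm D (x l) = real D"
      using kl by (intro AE_PiM_component prob_space_unif_sphere AE_unif_sphere_sqnorm D) auto
    then show "AE x in PiM ?I (\<lambda>_. unif_sphere D). (\<integral>\<^sup>+y. indicator ?E (x(k := y)) \<partial>unif_sphere D) \<le> ennreal ?\<beta>"
    proof eventually_elim
      case (elim x)
      let ?F = "{a \<in> space (unif_sphere D). real D * R < (cmod (cip D a (x l)))\<^sup>2}"
      have F: "?F \<in> sets (unif_sphere D)" by measurable
      have "(\<integral>\<^sup>+y. indicator ?E (x(k := y)) \<partial>unif_sphere D) \<le> (\<integral>\<^sup>+y. indicator ?F y \<partial>unif_sphere D)"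
        using kl by (intro nn_integral_mono) (auto simp: indicator_def)
      also have "\<dots> = emeasure (unif_sphere D) ?F" using F by (rule nn_integral_indicator)
      also have "\<dots> \<le> ennreal ?\<beta>" using elim by (intro unif_sphere_cip_tail D R) simp
      finally show ?case .
    qed
  qed
  also have "\<dots> = ennreal ?\<beta>" by (simp add: I.emeasure_space_1)
  finally show ?thesis .
qed

text \<open>The norms are right almost surely, so only the at most N^2 ordered pairs cost
  probability. The null set of wrong norms is put into B because recovery outside B is argued
  pointwise with exact norms.\<close>

lemma sphere_event:
  fixes R :: real and D N :: nat
  assumes D: "D \<ge> 1" and R: "R \<ge> 0"
  defines "B \<equiv> {A \<in> space (sphere_space D N). \<exists>k<N. sqnorm D (A k) \<noteq> real D \<or>
      (\<exists>l<N. k \<noteq> l \<and> real D * R < (cmod (cip D (A k) (A l)))\<^sup>2)}"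
  shows "B \<in> sets (sphere_space D N)"
    and "measure (sphere_space D N) B \<le> (real N)\<^sup>2 * (exp (- real D / 4) + 4 * exp (- R / 16))"
proof -
  interpret prob_space "sphere_space D N" by (rule prob_space_sphere_space)
  define T where "T = {(k, l). k < N \<and> l < N \<and> k \<noteq> l}"
  have T_sub: "T \<subseteq> {..<N} \<times> {..<N}" by (auto simp: T_def)
  then have fT: "finite T" by (rule finite_subset) simp
  let ?E = "\<lambda>(k, l). {A \<in> space (sphere_space D N). real D * R < (cmod (cip D (A k) (A l)))\<^sup>2}"
  let ?F = "\<lambda>k. {A \<in> space (sphere_space D N). sqnorm D (A k) \<noteq> real D}"
  have E: "?E i \<in> events" if "i \<in> T" for i
  proof (cases i)
    case (Pair k l)
    then have "(\<lambda>A. cip D (A k) (A l)) \<in> borel_measurable (sphere_space D N)"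
      using that by (intro measurable_sphere_cip) (auto simp: T_def)
    then show ?thesis unfolding Pair prod.case by measurable
  qed
  have F: "?F k \<in> events" if "k < N" for k
  proof -
    have "sqnorm D \<in> borel_measurable (unif_sphere D)" by measurable
    from measurable_compose[OF measurable_sphere_column[OF that] this] show ?thesis by measurable
  qed
  have B_eq: "B = (\<Union>k<N. ?F k) \<union> (\<Union>i\<in>T. ?E i)"
    unfolding B_def T_def by auto
  have UE: "(\<Union>i\<in>T. ?E i) \<in> events" using fT E by (intro sets.finite_UN) auto
  have UF: "(\<Union>k<N. ?F k) \<in> events" using F by (intro sets.finite_UN) auto
  show "B \<in> sets (sphere_space D N)" unfolding B_eq using UF UE by (rule sets.Un)
  have "prob (?F k) = 0" if "k < N" for k
  proof -
    have "AE A in sphere_space D N. sqnorm D (A k) = real D"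
      unfolding sphere_space_def using that
      by (intro AE_PiM_component prob_space_unif_sphere AE_unif_sphere_sqnorm D) auto
    then show ?thesis
      using F[OF that] by (subst prob_eq_0) auto
  qed
  then have F0: "prob (\<Union>k<N. ?F k) \<le> 0"
    using finite_measure_subadditive_finite[of "{..<N}" ?F] F by fastforce
  have "prob B \<le> prob (\<Union>k<N. ?F k) + prob (\<Union>i\<in>T. ?E i)"
    unfolding B_eq using UF UE by (rule measure_Un_le)
  also have "\<dots> \<le> (\<Sum>i\<in>T. prob (?E i))"
    using finite_measure_subadditive_finite[OF fT, of ?E] E F0 by fastforce
  also have "\<dots> \<le> (\<Sum>i\<in>T. exp (- real D / 4) + 4 * exp (- R / 16))"
  proof (rule sum_mono)
    fix i assume "i \<in> T"
    then obtain k l where i: "i = (k, l)" "k < N" "l < N" "k \<noteq> l" by (auto simp: T_def)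
    have "ennreal (prob (?E i)) \<le> ennreal (exp (- real D / 4) + 4 * exp (- R / 16))"
      using sphere_pair_tail[OF D R i(2,3,4)] unfolding i(1) prod.case emeasure_eq_measure .
    then show "prob (?E i) \<le> exp (- real D / 4) + 4 * exp (- R / 16)"
      by (subst (asm) ennreal_le_iff) (auto intro: add_nonneg_nonneg)
  qed
  also have "\<dots> = real (card T) * (exp (- real D / 4) + 4 * exp (- R / 16))" by simp
  also have "\<dots> \<le> (real N)\<^sup>2 * (exp (- real D / 4) + 4 * exp (- R / 16))"
  proof (intro mult_right_mono)
    have "card T \<le> card ({..<N} \<times> {..<N})" using T_sub by (intro card_mono) auto
    then show "real (card T) \<le> (real N)\<^sup>2"
      by (simp add: card_cartesian_product power2_eq_square flip: of_nat_mult)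
  qed (auto intro: add_nonneg_nonneg)
  finally show "measure (sphere_space D N) B \<le> (real N)\<^sup>2 * (exp (- real D / 4) + 4 * exp (- R / 16))" .
qed

section \<open>The joint model and the recovery event\<close>

lemma model_space_eq: "model_space D N M \<sigma> = sphere_space D N \<Otimes>\<^sub>M noise_space D N M \<sigma>"
  by (simp add: model_space_def sphere_space_def noise_space_def)

lemma prob_space_model: "prob_space (model_space D N M \<sigma>)"
proof -
  interpret A: prob_space "sphere_space D N" by (rule prob_space_sphere_space)
  interpret B: prob_space "noise_space D N M \<sigma>" by (rule prob_space_noise)
  interpret pair_prob_space "sphere_space D N" "noise_space D N M \<sigma>" ..
  show ?thesis unfolding model_space_eq by unfold_locales
qed

lemma measurable_calY:
  assumes k: "k < N"
  shows "(\<lambda>(A, H, Z). calY D N M \<gamma> A H Z k) \<in> borel_measurable (model_space D N M \<sigma>)"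
proof -
  let ?M = "model_space D N M \<sigma>"
  have A: "(\<lambda>\<omega>. fst \<omega> l i) \<in> borel_measurable ?M" if "l < N" "i < D" for l i
    unfolding model_space_eq by (rule measurable_compose[OF measurable_fst measurable_sphere_entry[OF that]])
  have H: "(\<lambda>\<omega>. fst (snd \<omega>) (l, m)) \<in> borel_measurable ?M" if "l < N" "m < M" for l m
    unfolding model_space_eq
    using measurable_compose[OF measurable_snd measurable_gram_vec[of "Inl l" N D m M \<sigma>], of "sphere_space D N"] that
    by (simp add: gram_vec_def case_prod_beta' InlI)
  have Z: "(\<lambda>\<omega>. snd (snd \<omega>) (i, m)) \<in> borel_measurable ?M" if "i < D" "m < M" for i m
    unfolding model_space_eq
    using measurable_compose[OF measurable_snd measurable_gram_vec[of "Inr i" N D m M \<sigma>], of "sphere_space D N"] that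
    by (simp add: gram_vec_def case_prod_beta' InrI)
  have "(\<lambda>\<omega>. calY D N M \<gamma> (fst \<omega>) (fst (snd \<omega>)) (snd (snd \<omega>)) k) \<in> borel_measurable ?M"
    unfolding calY_def Sigma_hat_def Ymat_def using k
    by (intro borel_measurable_sum borel_measurable_times borel_measurable_add borel_measurable_const
        measurable_compose[OF _ measurable_cnj] A H Z) auto
  then show ?thesis by (simp add: case_prod_beta')
qed

text \<open>Bounding the recovery probability through its complement requires this event to be
  measurable.\<close>

lemma sets_top_set_event:
  assumes S: "S \<subseteq> {..<N}"
  shows "{\<omega> \<in> space (model_space D N M \<sigma>). case \<omega> of (A, H, Z) \<Rightarrow> top_set_is N (calY D N M \<gamma> A H Z) S}
    \<in> sets (model_space D N M \<sigma>)"
proof -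
  let ?M = "model_space D N M \<sigma>"
  let ?Y = "\<lambda>k. (\<lambda>(A, H, Z). calY D N M \<gamma> A H Z k)"
  have [measurable]: "(\<lambda>\<omega>. Re (?Y k \<omega>)) \<in> borel_measurable ?M" if "k < N" for k
    using measurable_compose[OF measurable_calY[OF that] borel_measurable_Re] .
  have fS: "finite S" using S finite_subset by blast
  have "{\<omega> \<in> space ?M. \<forall>k\<in>S. \<forall>l\<in>{..<N} - S. Re (?Y l \<omega>) < Re (?Y k \<omega>)} \<in> sets ?M"
    using fS S by (intro sets.sets_Collect_finite_All' sets.sets_Collect_finite_All borel_measurable_less) auto
  also have "{\<omega> \<in> space ?M. \<forall>k\<in>S. \<forall>l\<in>{..<N} - S. Re (?Y l \<omega>) < Re (?Y k \<omega>)} =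
    {\<omega> \<in> space ?M. case \<omega> of (A, H, Z) \<Rightarrow> top_set_is N (calY D N M \<gamma> A H Z) S}"
    using S by (auto simp: top_set_is_def)
  finally show ?thesis .
qed

text \<open>Outside two cylinder sets, one over the bad A and one over the bad pairs (H, Z),
  recovery is deterministic. A cylinder has the probability of its base, so the two failure bounds
  add up.\<close>

lemma recovery_probability:
  fixes \<gamma> :: "nat \<Rightarrow> real" and S :: "nat set" and g g' \<sigma> R :: real and D N M :: nat
  defines "Q \<equiv> (g' * real (card S) + \<sigma>\<^sup>2) / g" and "K \<equiv> real (card S)"
  assumes S: "S \<subseteq> {..<N}" "S \<noteq> {}" "card S \<le> D" and \<gamma>0: "\<And>l. l < N \<Longrightarrow> l \<notin> S \<Longrightarrow> \<gamma> l = 0"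
    and g: "g > 0" and \<gamma>: "\<And>l. l \<in> S \<Longrightarrow> g \<le> \<gamma> l \<and> \<gamma> l \<le> g'"
    and D: "D \<ge> 1" and M: "M \<ge> 1" and R: "R \<ge> 0" and KR: "K * g' * R \<le> g * real D / 4"
    and Q: "Q \<ge> 1"
  shows "1 - (real N)\<^sup>2 * (exp (- real D / 4) + 4 * exp (- R / 16))
      - 16 * (real D)\<^sup>2 * exp (- real M * (1 / (96 * Q))\<^sup>2 / 2048)
    \<le> measure (model_space D N M \<sigma>)
        {\<omega> \<in> space (model_space D N M \<sigma>). case \<omega> of (A, H, Z) \<Rightarrow> top_set_is N (calY D N M \<gamma> A H Z) S}"
    (is "1 - ?p1 - ?p2 \<le> measure ?M ?G")
proof -
  interpret prob_space ?M by (rule prob_space_model)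
  interpret A: prob_space "sphere_space D N" by (rule prob_space_sphere_space)
  interpret B: prob_space "noise_space D N M \<sigma>" by (rule prob_space_noise)
  let ?\<omega> = "case_sum (\<lambda>_. 1) (\<lambda>_. sqrt (\<sigma>\<^sup>2 + g)) :: nat + nat \<Rightarrow> real"
  define \<delta> where "\<delta> = 1 / (96 * Q)"
  have \<delta>: "0 < \<delta>" "\<delta> \<le> 1" using Q by (auto simp: \<delta>_def)
  define B1 where "B1 = {A \<in> space (sphere_space D N). \<exists>k<N. sqnorm D (A k) \<noteq> real D \<or>
      (\<exists>l<N. k \<noteq> l \<and> real D * R < (cmod (cip D (A k) (A l)))\<^sup>2)}"
  define B2 where "B2 = {(H, Z) \<in> space (noise_space D N M \<sigma>). \<exists>p\<in>S <+> {..<D}. \<exists>q\<in>S <+> {..<D}. real M * \<delta> * (?\<omega> p * ?\<omega> q) <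
      cmod ((\<Sum>m<M. gram_vec H Z p m * cnj (gram_vec H Z q m)) - of_nat M * of_real (if p = q then variance_of \<sigma> p else 0))}"
  note B1 = sphere_event[OF D R, of N, folded B1_def]
  note B2 = noise_event[OF D M S(1,3) g \<delta>, of \<sigma>, folded B2_def]
  let ?C1 = "B1 \<times> space (noise_space D N M \<sigma>)" and ?C2 = "space (sphere_space D N) \<times> B2"
  have G: "?G \<in> events" by (rule sets_top_set_event[OF S(1)])
  have C: "?C1 \<in> events" "?C2 \<in> events"
    unfolding model_space_eq using B1(1) B2(1) by auto
  have "space ?M - ?G \<subseteq> ?C1 \<union> ?C2"
  proof
    fix x assume x: "x \<in> space ?M - ?G"
    obtain A H Z where xeq: "x = (A, H, Z)" by (cases x)
    have sp: "A \<in> space (sphere_space D N)" "(H, Z) \<in> space (noise_space D N M \<sigma>)"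
      using x unfolding xeq model_space_eq space_pair_measure by auto
    show "x \<in> ?C1 \<union> ?C2"
    proof (rule ccontr)
      assume "x \<notin> ?C1 \<union> ?C2"
      then have nA: "A \<notin> B1" and nB: "(H, Z) \<notin> B2" using sp unfolding xeq by auto
      have "top_set_is N (calY D N M \<gamma> A H Z) S"
      proof (rule top_set_of_good_event[where R = R and \<sigma> = \<sigma> and g = g and g' = g'])
        show "sqnorm D (A k) = real D" if "k < N" for k
          using nA sp(1) that unfolding B1_def by blast
        show "(cmod (cip D (A k) (A l)))\<^sup>2 \<le> real D * R" if "k < N" "l < N" "k \<noteq> l" for k l
        proof -
          have "\<not> real D * R < (cmod (cip D (A k) (A l)))\<^sup>2"
            using nA sp(1) that unfolding B1_def by blast
          then show ?thesis by simp
        qed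
        show "cmod ((\<Sum>m<M. gram_vec H Z p m * cnj (gram_vec H Z q m)) - of_nat M *
          complex_of_real (if p = q then (case p of Inl _ \<Rightarrow> 1 | Inr _ \<Rightarrow> \<sigma>\<^sup>2) else 0))
          \<le> real M * (1 / (96 * ((g' * real (card S) + \<sigma>\<^sup>2) / g))) * (?\<omega> p * ?\<omega> q)"
          if "p \<in> S <+> {..<D}" "q \<in> S <+> {..<D}" for p q
        proof -
          have "\<not> real M * \<delta> * (?\<omega> p * ?\<omega> q) < cmod ((\<Sum>m<M. gram_vec H Z p m * cnj (gram_vec H Z q m))
              - of_nat M * of_real (if p = q then variance_of \<sigma> p else 0))"
            using nB sp(2) that unfolding B2_def by blast
          then show ?thesis by (simp only: not_less \<delta>_def Q_def variance_of_def)
        qed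
      qed (use S \<gamma>0 g \<gamma> D M R KR in \<open>auto simp: K_def\<close>)
      then show False using x unfolding xeq by auto
    qed
  qed
  then have "prob (space ?M - ?G) \<le> prob (?C1 \<union> ?C2)"
    using C by (intro finite_measure_mono) auto
  also have "\<dots> \<le> prob ?C1 + prob ?C2" using C by (rule measure_Un_le)
  also have "prob ?C1 = A.prob B1"
    unfolding model_space_eq measure_def using B1(1)
    by (subst B.emeasure_pair_measure_Times) (auto simp: B.emeasure_space_1)
  also have "prob ?C2 = B.prob B2"
    unfolding model_space_eq measure_def using B2(1)
    by (subst B.emeasure_pair_measure_Times) (auto simp: A.emeasure_space_1)
  finally have "1 - prob ?G \<le> A.prob B1 + B.prob B2" by (simp only: prob_compl[OF G])
  then show ?thesis using B1(2) B2(2) unfolding \<delta>_def by linarith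
qed

text \<open>For R = 32 ln (N D) the term exp (- R / 16) equals (N D)^(-2), and \<open>L\<close>
  keeps exp (- D / 4) below the same value. The N^2 cancels and leaves (1 + 4) / D^2, which is
  weakened to the rate of the theorem.\<close>

lemma sphere_failure_le:
  assumes D: "D \<ge> 1" and N: "N \<ge> 1" and L: "ln (real N * real D) \<le> real D / 128"
  shows "(real N)\<^sup>2 * (exp (- real D / 4) + 4 * exp (- (32 * ln (real N * real D)) / 16))
    \<le> 5 / (real D * sqrt (real D))"
proof -
  let ?x = "real N * real D"
  have x: "?x > 0" using D N by simp
  have l0: "0 \<le> ln ?x"
  proof -
    have "1 * 1 \<le> ?x" using D N by (intro mult_mono) auto
    then show ?thesis by simp
  qed
  have e: "exp (- (32 * ln ?x) / 16) = 1 / ?x\<^sup>2"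
  proof -
    have "exp (- (32 * ln ?x) / 16) = inverse (exp (2 * ln ?x))" by (simp add: exp_minus)
    also have "exp (2 * ln ?x) = ?x\<^sup>2" using x by (simp add: exp_double)
    finally show ?thesis by (simp add: inverse_eq_divide)
  qed
  have "exp (- real D / 4) \<le> exp (- (32 * ln ?x) / 16)" using L l0 by simp
  then have "(real N)\<^sup>2 * (exp (- real D / 4) + 4 * exp (- (32 * ln ?x) / 16)) \<le> (real N)\<^sup>2 * (5 * (1 / ?x\<^sup>2))"
    unfolding e by (intro mult_left_mono) auto
  also have "\<dots> = 5 / (real D * real D)" using N D by (simp add: power2_eq_square)
  also have "\<dots> \<le> 5 / (real D * sqrt (real D))"
  proof -
    have "sqrt (real D) \<le> real D" using D by (intro real_le_lsqrt) (auto simp: power2_eq_square)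
    then show ?thesis using D by (intro divide_left_mono mult_left_mono mult_pos_pos) auto
  qed
  finally show ?thesis .
qed

text \<open>The constant is 2 * 2048 * 96^2, chosen so that the exponent is at least twice the
  logarithm of y = (e D)^2 / \<epsilon>. The bound becomes 16 D^2 / y^2 = (16 / e^4) \<epsilon>^2 /
  D^2, and e \<ge> 2 finishes.\<close>

lemma noise_failure_le:
  assumes D: "D \<ge> 1" and \<epsilon>: "0 < \<epsilon>" "\<epsilon> < 1" and Q: "Q \<ge> 1"
    and M: "real M \<ge> 37748736 * Q\<^sup>2 * ln ((exp 1 * real D)\<^sup>2 / \<epsilon>)"
  shows "16 * (real D)\<^sup>2 * exp (- real M * (1 / (96 * Q))\<^sup>2 / 2048) \<le> \<epsilon>"
proof -
  let ?y = "(exp 1 * real D)\<^sup>2 / \<epsilon>"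
  have y: "?y > 0" using D \<epsilon> by simp
  have "2 * ln ?y = 37748736 * Q\<^sup>2 * ln ?y * ((1 / (96 * Q))\<^sup>2 / 2048)"
    using Q by (simp add: power_mult_distrib power_divide)
  also have "\<dots> \<le> real M * ((1 / (96 * Q))\<^sup>2 / 2048)" by (intro mult_right_mono M) auto
  finally have "exp (- real M * (1 / (96 * Q))\<^sup>2 / 2048) \<le> exp (- (2 * ln ?y))" by simp
  also have "\<dots> = 1 / ?y\<^sup>2"
    using y by (simp add: exp_minus exp_double inverse_eq_divide)
  finally have "16 * (real D)\<^sup>2 * exp (- real M * (1 / (96 * Q))\<^sup>2 / 2048) \<le> 16 * (real D)\<^sup>2 * (1 / ?y\<^sup>2)"
    by (intro mult_left_mono) auto
  also have "\<dots> = (16 / exp 1 ^ 4) * (\<epsilon>\<^sup>2 / (real D)\<^sup>2)"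
    using D \<epsilon> by (simp add: field_simps power2_eq_square power4_eq_xxxx)
  also have "\<dots> \<le> 1 * (\<epsilon>\<^sup>2 / 1)"
  proof (intro mult_mono divide_left_mono)
    have "(2::real) ^ 4 \<le> exp 1 ^ 4" using exp_ge_add_one_self[of 1] by (intro power_mono) auto
    then show "16 / exp 1 ^ 4 \<le> (1::real)" by simp
    show "1 \<le> (real D)\<^sup>2" using D by simp
  qed (use D in auto)
  also have "\<dots> \<le> \<epsilon>" using \<epsilon> by (simp add: power2_eq_square mult_left_le)
  finally show ?thesis .
qed

text \<open>The witnesses are c0 = 5 = 1 + 4, from the two terms of the correlation tail; c4 = 2 *
  2048 * 96^2, from the Gram precision 1 / (96 Q) and the Chernoff exponent; and c5 = 1 / (4 * 32),
  where 32 is the factor in R and 1/4 the admissible leakage off the support.\<close>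

theorem theorem3:
  shows "\<exists>c0 c4 c5 :: real. c0 > 0 \<and> c4 > 0 \<and> c5 > 0 \<and>
    (\<forall>(\<epsilon>::real) (D::nat) (N::nat) (M::nat) (K::nat) (\<gamma>::nat \<Rightarrow> real) (\<sigma>::real).
      let S = {k. k < N \<and> \<gamma> k \<noteq> 0};
          gmin = Min (\<gamma> ` S); gmax = Max (\<gamma> ` S); c\<gamma> = gmax / gmin
      in (0 < \<epsilon> \<and> \<epsilon> < 1 \<and> D \<ge> 1 \<and> N \<ge> 1 \<and> M \<ge> 1 \<and>
          (\<forall>k<N. \<gamma> k \<ge> 0) \<and> card S = K \<and>
          real M \<ge> c4 * (c\<gamma> * real K + \<sigma>^2 / gmin)^2 * ln ((exp 1 * real D)^2 / \<epsilon>) \<and>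
          real K \<le> c5 * real D / (c\<gamma> * ln (real N * real D)))
         \<longrightarrow> measure (model_space D N M \<sigma>)
               {\<omega> \<in> space (model_space D N M \<sigma>).
                  case \<omega> of (A, H, Z) \<Rightarrow> top_set_is N (calY D N M \<gamma> A H Z) S}
             \<ge> 1 - \<epsilon> - c0 / (real D * sqrt (real D)))"
proof (rule exI[of _ 5], rule exI[of _ 37748736], rule exI[of _ "1/128"], intro conjI allI)
  fix \<epsilon> :: real and D N M K :: nat and \<gamma> :: "nat \<Rightarrow> real" and \<sigma> :: real
  define S where "S = {k. k < N \<and> \<gamma> k \<noteq> 0}"
  define g where "g = Min (\<gamma> ` S)"
  define g' where "g' = Max (\<gamma> ` S)"
  let ?G = "{\<omega> \<in> space (model_space D N M \<sigma>). case \<omega> of (A, H, Z) \<Rightarrow> top_set_is N (calY D N M \<gamma> A H Z) S}"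
  have S_sub: "S \<subseteq> {..<N}" by (auto simp: S_def)
  then have fS: "finite S" using finite_subset by blast
  interpret prob_space "model_space D N M \<sigma>" by (rule prob_space_model)
  have main: "1 - \<epsilon> - 5 / (real D * sqrt (real D)) \<le> prob ?G"
    if \<epsilon>: "0 < \<epsilon>" "\<epsilon> < 1" and D: "D \<ge> 1" and N: "N \<ge> 1" and M: "M \<ge> 1"
      and \<gamma>: "\<forall>k<N. \<gamma> k \<ge> 0" and K: "card S = K"
      and hM: "real M \<ge> 37748736 * (g' / g * real K + \<sigma>^2 / g)^2 * ln ((exp 1 * real D)^2 / \<epsilon>)"
      and hK: "real K \<le> 1/128 * real D / (g' / g * ln (real N * real D))"
  proof -
    \<comment> \<open>For empty S the event is the whole space, and the \<open>Min\<close> and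
      \<open>Max\<close> defining g and g' carry no information. For D = 1 the term 5 / (D sqrt D)
      makes the claimed lower bound negative.\<close>
    consider (empty) "S = {}" | (one) "D = 1" | (main) "S \<noteq> {}" "D \<ge> 2" using D by linarith
    then show ?thesis
    proof cases
      case empty
      then have "?G = space (model_space D N M \<sigma>)" by (auto simp: top_set_is_def)
      then have "prob ?G = 1" by (simp add: prob_space)
      moreover have "0 \<le> 5 / (real D * sqrt (real D))" by simp
      ultimately show ?thesis using \<epsilon> by linarith
    next
      case one
      then have "1 - \<epsilon> - 5 / (real D * sqrt (real D)) \<le> 0" using \<epsilon> by simp
      then show ?thesis using measure_nonneg order_trans by blast
    next
      case main
      let ?l = "ln (real N * real D)"
      have fin: "finite (\<gamma> ` S)" "\<gamma> ` S \<noteq> {}" using fS main(1) by auto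
      have g: "g > 0" unfolding g_def using fin \<gamma> by (subst Min_gr_iff) (auto simp: S_def less_le)
      have \<gamma>S: "g \<le> \<gamma> l \<and> \<gamma> l \<le> g'" if "l \<in> S" for l
        unfolding g_def g'_def using fin that by auto
      then have gg: "g \<le> g'" using main(1) by fastforce
      have K1: "real K \<ge> 1" using fS main(1) K by (cases K) auto
      have c1: "1 \<le> g' / g" using g gg by simp
      \<comment> \<open>D \<ge> 2 keeps the logarithm at or above 1/2, so that the quotient in
        \<open>hK\<close> is a genuine division by a positive number.\<close>
      have "2 \<le> real N * real D" using N main(2) mult_mono[of 1 "real N" 2 "real D"] by simp
      then have "ln 2 \<le> ?l" by simp
      moreover have "1 / 2 \<le> ln (2 :: real)"
        using exp_half_le_2 by (subst ln_ge_iff) auto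
      ultimately have l: "1 / 2 \<le> ?l" by linarith
      have cl: "?l \<le> g' / g * ?l" using c1 l mult_right_mono[of 1 "g' / g" ?l] by simp
      then have clpos: "g' / g * ?l > 0" using l by linarith
      have Kl: "real K * (g' / g * ?l) \<le> real D / 128"
      proof -
        have "real K * (g' / g * ?l) \<le> 1/128 * real D"
          using hK unfolding pos_le_divide_eq[OF clpos] .
        then show ?thesis by (simp only: mult_1 times_divide_eq_left)
      qed
      \<comment> \<open>Since K and g' / g are at least 1, the sparsity condition also limits ln (N
        D), hence N, in terms of D; the short-vector term of the correlation tail relies on
        this.\<close>
      have "1 * (g' / g * ?l) \<le> real K * (g' / g * ?l)" using K1 clpos by (intro mult_right_mono) auto
      then have lD: "?l \<le> real D / 128" using cl Kl by linarith
      \<comment> \<open>The same condition with the logarithm replaced by its lower bound 1/2 yields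
        K \<le> D, needed to count the Gram rows.\<close>
      have "real K * (1 / 2) \<le> real K * (g' / g * ?l)" by (intro mult_left_mono order_trans[OF l cl]) simp
      then have "real K \<le> real D" using Kl by linarith
      then have KD: "card S \<le> D" using K by simp
      define Q where "Q = (g' * real (card S) + \<sigma>\<^sup>2) / g"
      have Q_eq: "Q = g' / g * real K + \<sigma>\<^sup>2 / g" by (simp add: Q_def K add_divide_distrib)
      have "1 * 1 \<le> g' / g * real K" using c1 K1 by (intro mult_mono) auto
      moreover have "0 \<le> \<sigma>\<^sup>2 / g" using g by simp
      ultimately have Q1: "Q \<ge> 1" unfolding Q_eq by linarith
      \<comment> \<open>With c5 = 1/128 the leakage is at most 32 g D / 128 = g D / 4.\<close>
      have KR: "real (card S) * g' * (32 * ?l) \<le> g * real D / 4"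
      proof -
        have "real (card S) * g' * (32 * ?l) = 32 * g * (real K * (g' / g * ?l))" using g K by simp
        also have "\<dots> \<le> 32 * g * (real D / 128)" using g by (intro mult_left_mono Kl) auto
        finally show ?thesis by simp
      qed
      have "1 - (real N)\<^sup>2 * (exp (- real D / 4) + 4 * exp (- (32 * ?l) / 16))
          - 16 * (real D)\<^sup>2 * exp (- real M * (1 / (96 * Q))\<^sup>2 / 2048) \<le> prob ?G"
        unfolding Q_def
      proof (rule recovery_probability[OF S_sub main(1) KD])
        show "\<gamma> l = 0" if "l < N" "l \<notin> S" for l using that by (simp add: S_def)
        show "0 \<le> 32 * ?l" using l by simp
        show "1 \<le> (g' * real (card S) + \<sigma>\<^sup>2) / g" using Q1 by (simp only: Q_def)
      qed (use g \<gamma>S D M KR in auto)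
      moreover have "(real N)\<^sup>2 * (exp (- real D / 4) + 4 * exp (- (32 * ?l) / 16)) \<le> 5 / (real D * sqrt (real D))"
        by (rule sphere_failure_le[OF D N lD])
      moreover have "16 * (real D)\<^sup>2 * exp (- real M * (1 / (96 * Q))\<^sup>2 / 2048) \<le> \<epsilon>"
        using noise_failure_le[OF D \<epsilon> Q1] hM by (simp only: Q_eq)
      ultimately show ?thesis by linarith
    qed
  qed
  show "let S = {k. k < N \<and> \<gamma> k \<noteq> 0};
          gmin = Min (\<gamma> ` S); gmax = Max (\<gamma> ` S); c\<gamma> = gmax / gmin
      in (0 < \<epsilon> \<and> \<epsilon> < 1 \<and> D \<ge> 1 \<and> N \<ge> 1 \<and> M \<ge> 1 \<and>
          (\<forall>k<N. \<gamma> k \<ge> 0) \<and> card S = K \<and>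
          real M \<ge> 37748736 * (c\<gamma> * real K + \<sigma>^2 / gmin)^2 * ln ((exp 1 * real D)^2 / \<epsilon>) \<and>
          real K \<le> 1/128 * real D / (c\<gamma> * ln (real N * real D)))
         \<longrightarrow> measure (model_space D N M \<sigma>)
               {\<omega> \<in> space (model_space D N M \<sigma>).
                  case \<omega> of (A, H, Z) \<Rightarrow> top_set_is N (calY D N M \<gamma> A H Z) S}
             \<ge> 1 - \<epsilon> - 5 / (real D * sqrt (real D))"
    unfolding Let_def S_def[symmetric] g_def[symmetric] g'_def[symmetric] using main by blast
qed simp_all

end
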